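(* Let $G$ be an infinite bounded Abelian group. Then $G$ admits a Hausdorff minimally almost periodic group topology if and only if all leading Ulm-Kaplansky invariants of $G$ are infinite.
   Context: $G$ is bounded if $\exp G<\infty$, where $\exp G$ is the least common multiple of the orders of the elements of $G$. A bounded Abelian group $G$ has the form $G=\bigoplus_{p\in M}\bigoplus_{i=1}^{n_p}\mathbb{Z}(p^i)^{(k_{i,p})}$, where $M$ is a finite set of primes, the $k_{i,p}$ are cardinals, and $k_{n_p,p}\neq 0$ for each $p\in M$ (so $p^{n_p}$ is the exponent of the $p$-component). The leading Ulm-Kaplansky invariants of $G$ are the cardinals $k_{n_p,p}$, $p\in M$. A topological Abelian group $X$ (or its topology) is minimally almost periodic (MinAP) if its von Neumann radical $\mathbf{n}(X)=\bigcap_{\chi\in X^\wedge}\ker\chi$ equals $X$, where $X^\wedge$ is the group of continuous characters (continuous homomorphisms to the circle group). *)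

theory Defs
  imports "HOL-Analysis.Analysis" "HOL-Algebra.Algebra"
begin

subsection \<open>Bounded groups and leading Ulm-Kaplansky invariants\<close>

text \<open>In \<^typ>\<open>nat\<close>, an \<^const>\<open>Lcm\<close> equal to \<open>0\<close> encodes the exponent \<open>\<infinity>\<close>: elements of infinite
  order have order \<open>0\<close>, and \<^const>\<open>Lcm\<close> of an infinite set of naturals is \<open>0\<close>.\<close>

definition group_exponent :: "('a, 'b) monoid_scheme \<Rightarrow> nat" where
  "group_exponent G = Lcm (group.ord G ` carrier G)"

definition bounded_group :: "('a, 'b) monoid_scheme \<Rightarrow> bool" where
  "bounded_group G \<longleftrightarrow> group_exponent G \<noteq> 0"

text \<open>The multiplicity \<open>k\<close> of the summand \<open>\<int>(p\<^sup>i)\<close>, a cardinal, is given by an index set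
  \<open>K i p\<close> of that cardinality. Index sets may be taken inside the type of elements of \<open>G\<close>, because
  a direct sum of \<open>k\<close> nontrivial groups has at least \<open>k\<close> elements.\<close>

definition cyclic_decomposition ::
  "('a, 'b) monoid_scheme \<Rightarrow> nat set \<Rightarrow> (nat \<Rightarrow> nat) \<Rightarrow> (nat \<Rightarrow> nat \<Rightarrow> 'a set) \<Rightarrow> bool" where
  "cyclic_decomposition G M n K \<longleftrightarrow>
     finite M \<and>
     (\<forall>p\<in>M. Factorial_Ring.prime p \<and> 1 \<le> n p \<and> K (n p) p \<noteq> {}) \<and>
     G \<cong> sum_group M (\<lambda>p. sum_group {1..n p} (\<lambda>i.
            sum_group (K i p) (\<lambda>_. integer_mod_group (p ^ i))))"

text \<open>Cardinals are represented by the cardinal orders \<^term>\<open>card_of A\<close> of index sets. They do not depend,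
  up to order isomorphism, on the decomposition.\<close>

definition leading_ulm_kaplansky_invariants :: "('a, 'b) monoid_scheme \<Rightarrow> 'a rel set" where
  "leading_ulm_kaplansky_invariants G =
     {card_of (K (n p) p) | M n K p. cyclic_decomposition G M n K \<and> p \<in> M}"

subsection \<open>Minimally almost periodic group topologies\<close>

definition group_topology :: "('a, 'b) monoid_scheme \<Rightarrow> 'a topology \<Rightarrow> bool" where
  "group_topology G T \<longleftrightarrow>
     topspace T = carrier G \<and>
     continuous_map (prod_topology T T) T (\<lambda>(x, y). x \<otimes>\<^bsub>G\<^esub> y) \<and>
     continuous_map T T (\<lambda>x. inv\<^bsub>G\<^esub> x)"

definition circle_group :: "complex monoid" where
  "circle_group = \<lparr>carrier = sphere 0 1, monoid.mult = (*), one = 1\<rparr>"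

definition continuous_characters ::
  "('a, 'b) monoid_scheme \<Rightarrow> 'a topology \<Rightarrow> ('a \<Rightarrow> complex) set" where
  "continuous_characters G T =
     {\<xi> \<in> hom G circle_group. continuous_map T (top_of_set (carrier circle_group)) \<xi>}"

definition von_neumann_radical :: "('a, 'b) monoid_scheme \<Rightarrow> 'a topology \<Rightarrow> 'a set" where
  "von_neumann_radical G T = (\<Inter>\<xi>\<in>continuous_characters G T. kernel G circle_group \<xi>)"

definition minimally_almost_periodic :: "('a, 'b) monoid_scheme \<Rightarrow> 'a topology \<Rightarrow> bool" where
  "minimally_almost_periodic G T \<longleftrightarrow> von_neumann_radical G T = carrier G"

end

theory Submission
  imports Defs
begin

text \<open>Suppose first that for some prime \<open>p\<close> the group has only finitely many cyclic summands of the
  maximal order \<open>p ^ n p\<close>, and let \<open>m\<close> be the exponent of the group divided by \<open>p\<close>. Then the group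
  of \<open>m\<close>-th powers is finite and nontrivial. In a Hausdorff group topology it is discrete, so every character of it,
  composed with the continuous map \<open>x \<mapsto> x\<^sup>m\<close>, is a continuous character of the whole group. A nontrivial one
  shows that the topology is not minimally almost periodic (\<open>not_minimally_almost_periodic\<close>).

  Conversely, the step functions \<open>[0,1) \<rightarrow> \<int>/N\<close>, topologized by convergence in measure, form a
  minimally almost periodic group. The norm of a function is the measure of its support, so the functions supported in a
  short interval form a subgroup contained in a small neighbourhood of \<open>0\<close>. A continuous character maps
  this subgroup to a subgroup of the circle close to \<open>1\<close>, hence to \<open>1\<close>, and every step function is a sum of
  functions supported in short intervals. The indicator functions of the intervals \<open>[0, q)\<close>, with \<open>q\<close> in a dense
  set, are independent of order \<open>N\<close>. They stay independent if multiples \<open>(N/d) 1\<^bsub>[0, q)\<^esub>\<close> of order \<open>d\<close>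
  are added for finitely many further \<open>q\<close>, and the group generated by all of them still has enough small subgroups. So all groups
  \<open>\<int>(N)\<^sup>(\<^sup>\<omega>\<^sup>) \<oplus> F\<close> with \<open>F\<close> finite of exponent dividing \<open>N\<close> are realized by step functions
  (\<open>minimally_almost_periodic_topology\<close>).

  A bounded abelian group is a direct sum of cyclic groups of prime power order
  (\<open>bounded_subgroup_has_basis\<close>). If all leading invariants are infinite, then the summands can be sorted into
  blocks of the above form: an infinite number of summands of equal order splits into countably infinite sets, and
  the summands whose order occurs only finitely often join blocks of maximal order for the same prime
  (\<open>exists_block_labelling\<close>). The supremum of the norms of the blocks is a norm on the group, and a
  character that is trivial on every block is trivial.\<close>

section \<open>Integer combinations and independence\<close>

context comm_group
begin

text \<open>Integer combinations of group elements are elements of the free abelian group on the carrier;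
  evaluating them is the homomorphism given by the universal property. Keeping the formal combination
  apart from its value makes independence a statement about coefficients.\<close>

definition frag_eval :: "('a \<Rightarrow>\<^sub>0 int) \<Rightarrow> 'a" where
  "frag_eval = (SOME h. h \<in> hom (free_Abelian_group (carrier G)) G \<and> (\<forall>x\<in>carrier G. h (frag_of x) = x))"

lemma frag_eval_hom: "frag_eval \<in> hom (free_Abelian_group (carrier G)) G"
  and frag_eval_of [simp]: "x \<in> carrier G \<Longrightarrow> frag_eval (frag_of x) = x"
proof -
  have "\<exists>h. h \<in> hom (free_Abelian_group (carrier G)) G \<and> (\<forall>x\<in>carrier G. h (frag_of x) = x)"
    by (rule free_Abelian_group_universal[of "\<lambda>x. x" "carrier G"]) auto
  from someI_ex[OF this]
  show "frag_eval \<in> hom (free_Abelian_group (carrier G)) G"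
    and "x \<in> carrier G \<Longrightarrow> frag_eval (frag_of x) = x"
    by (auto simp: frag_eval_def)
qed

lemma frag_eval_closed [simp]:
  "Poly_Mapping.keys c \<subseteq> carrier G \<Longrightarrow> frag_eval c \<in> carrier G"
  using frag_eval_hom by (auto simp: hom_def Pi_iff)

lemma frag_eval_add:
  "\<lbrakk>Poly_Mapping.keys c \<subseteq> carrier G; Poly_Mapping.keys d \<subseteq> carrier G\<rbrakk>
    \<Longrightarrow> frag_eval (c + d) = frag_eval c \<otimes> frag_eval d"
  using frag_eval_hom by (auto simp: hom_def)

lemma frag_eval_cmul:
  assumes "Poly_Mapping.keys c \<subseteq> carrier G"
  shows "frag_eval (frag_cmul k c) = frag_eval c [^] k"
proof -
  interpret F: group "free_Abelian_group (carrier G)" by simp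
  interpret group_hom "free_Abelian_group (carrier G)" G frag_eval
    using frag_eval_hom by unfold_locales
  show ?thesis
    using hom_int_pow[of c k] assms by simp
qed

lemma frag_eval_0 [simp]: "frag_eval 0 = \<one>"
  using frag_eval_cmul[of 0 0] by simp

lemma frag_eval_minus:
  "Poly_Mapping.keys c \<subseteq> carrier G \<Longrightarrow> frag_eval (- c) = inv (frag_eval c)"
  using frag_eval_cmul[of c "-1"] by (simp add: int_pow_neg)

lemma frag_eval_diff:
  "\<lbrakk>Poly_Mapping.keys c \<subseteq> carrier G; Poly_Mapping.keys d \<subseteq> carrier G\<rbrakk>
    \<Longrightarrow> frag_eval (c - d) = frag_eval c \<otimes> inv (frag_eval d)"
  using frag_eval_add[of c "-d"] by (simp add: frag_eval_minus)

lemma frag_eval_trivial: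
  assumes "Poly_Mapping.keys c \<subseteq> carrier G"
    and "\<And>b. b \<in> Poly_Mapping.keys c \<Longrightarrow> int (ord b) dvd Poly_Mapping.lookup c b"
  shows "frag_eval c = \<one>"
proof -
  have *: "frag_eval (\<Sum>i\<in>I. frag_cmul (Poly_Mapping.lookup c i) (frag_of i)) = \<one> \<and>
     Poly_Mapping.keys (\<Sum>i\<in>I. frag_cmul (Poly_Mapping.lookup c i) (frag_of i)) \<subseteq> carrier G"
    if "finite I" "I \<subseteq> Poly_Mapping.keys c" for I
    using that
  proof (induction I rule: finite_induct)
    case (insert i I)
    have i: "i \<in> carrier G" using insert.prems assms(1) by auto
    have "frag_eval (frag_cmul (Poly_Mapping.lookup c i) (frag_of i)) = \<one>"
      using i insert.prems assms(2) by (simp add: frag_eval_cmul int_pow_eq_id)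
    moreover have "Poly_Mapping.keys (frag_cmul (Poly_Mapping.lookup c i) (frag_of i)) \<subseteq> carrier G"
      using i keys_cmul by fastforce
    ultimately show ?case
      using insert keys_add[of "frag_cmul (Poly_Mapping.lookup c i) (frag_of i)" "\<Sum>i\<in>I. frag_cmul (Poly_Mapping.lookup c i) (frag_of i)"]
      by (auto simp: frag_eval_add)
  qed auto
  then show ?thesis
    by (metis finite_keys frag_expansion frag_extend_def order_refl)
qed

text \<open>The order \<open>0\<close> of an element of infinite order makes this the usual notion of independence for
  arbitrary abelian groups: an independent set is one whose elements generate the direct sum of
  the cyclic groups that they generate.\<close>

definition independent :: "'a set \<Rightarrow> bool" where
  "independent A \<longleftrightarrow> A \<subseteq> carrier G \<and>
     (\<forall>c. Poly_Mapping.keys c \<subseteq> A \<longrightarrow> frag_eval c = \<one> \<longrightarrow>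
        (\<forall>b\<in>A. int (ord b) dvd Poly_Mapping.lookup c b))"

definition combinations :: "'a set \<Rightarrow> 'a set" where
  "combinations A = frag_eval ` {c. Poly_Mapping.keys c \<subseteq> A}"

lemma combinationsE:
  assumes "x \<in> combinations A"
  obtains c where "Poly_Mapping.keys c \<subseteq> A" "frag_eval c = x"
  using assms unfolding combinations_def by blast

lemma combinationsI: "\<lbrakk>Poly_Mapping.keys c \<subseteq> A; frag_eval c = x\<rbrakk> \<Longrightarrow> x \<in> combinations A"
  unfolding combinations_def by blast

text \<open>If a relation involves \<open>x\<close> with a coefficient prime to \<open>p\<close>, then this coefficient is
  invertible modulo the order of \<open>x\<close>, so that \<open>x\<close> is a combination of the others. The other relations
  do not involve \<open>x\<close> at all.\<close>

lemma independent_insert_prime_order: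
  assumes A: "independent A" and x: "x \<in> carrier G" "x \<notin> combinations A"
    and p: "Factorial_Ring.prime p" "ord x = p"
  shows "independent (insert x A)"
  unfolding independent_def
proof (intro conjI allI impI)
  show AG: "insert x A \<subseteq> carrier G"
    using A x by (auto simp: independent_def)
  fix c assume c: "Poly_Mapping.keys c \<subseteq> insert x A" and c1: "frag_eval c = \<one>"
  define m where "m = Poly_Mapping.lookup c x"
  define d where "d = c - frag_cmul m (frag_of x)"
  have look: "Poly_Mapping.lookup d b = (if b = x then 0 else Poly_Mapping.lookup c b)" for b
    by (simp add: d_def m_def lookup_minus)
  have d: "Poly_Mapping.keys d \<subseteq> A"
    using c by (auto simp: in_keys_iff look split: if_splits)
  have dG: "Poly_Mapping.keys d \<subseteq> carrier G" using d AG by auto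
  have xG: "Poly_Mapping.keys (frag_cmul k (frag_of x)) \<subseteq> carrier G" for k
    using x(1) keys_cmul by fastforce
  have "c = d + frag_cmul m (frag_of x)" by (simp add: d_def)
  then have eq: "frag_eval d \<otimes> x [^] m = \<one>"
    using c1 dG xG x by (simp add: frag_eval_add frag_eval_cmul)
  have pm: "int p dvd m"
  proof (rule ccontr)
    assume "\<not> int p dvd m"
    then have "coprime (int p) m"
      using p(1) by (intro prime_imp_coprime) auto
    then obtain u v where uv: "u * int p + v * m = 1"
      using bezout_int[of "int p" m] by auto
    have xm: "x [^] m = inv (frag_eval d)"
      using eq dG x(1) by (metis frag_eval_closed int_pow_closed inv_equality inv_inv)
    have "x = x [^] (u * int p + v * m)" using uv x by simp
    also have "\<dots> = x [^] (u * int p) \<otimes> x [^] (m * v)"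
      using x by (simp add: int_pow_mult mult.commute)
    also have "x [^] (u * int p) = \<one>"
      using x p by (simp add: int_pow_eq_id)
    also have "x [^] (m * v) = inv (frag_eval d) [^] v"
      using x xm by (simp flip: int_pow_pow)
    also have "\<dots> = frag_eval (frag_cmul (- v) d)"
      using dG by (simp add: frag_eval_cmul int_pow_neg int_pow_inv)
    finally have "x = frag_eval (frag_cmul (- v) d)"
      using dG keys_cmul by (metis frag_eval_closed l_one order_trans)
    moreover have "Poly_Mapping.keys (frag_cmul (- v) d) \<subseteq> A"
      using d keys_cmul by blast
    ultimately show False
      using x(2) by (auto simp: combinations_def)
  qed
  then have "x [^] m = \<one>" using x p by (simp add: int_pow_eq_id)
  then have "frag_eval d = \<one>" using eq dG by simp
  then have *: "\<forall>b\<in>A. int (ord b) dvd Poly_Mapping.lookup d b"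
    using A d by (auto simp: independent_def)
  show "\<forall>b\<in>insert x A. int (ord b) dvd Poly_Mapping.lookup c b"
    using * pm p by (auto simp: look m_def split: if_splits)
qed

lemma independent_Union_chain:
  assumes ne: "C \<noteq> {}" and ch: "subset.chain U C" and ind: "\<And>A. A \<in> C \<Longrightarrow> independent A"
  shows "independent (\<Union>C)"
  unfolding independent_def
proof (intro conjI allI impI ballI)
  show "\<Union>C \<subseteq> carrier G" using ind by (auto simp: independent_def)
  fix c b assume c: "Poly_Mapping.keys c \<subseteq> \<Union>C" and c1: "frag_eval c = \<one>" and b: "b \<in> \<Union>C"
  obtain A where "A \<in> C" "insert b (Poly_Mapping.keys c) \<subseteq> A"
    using finite_subset_Union_chain[of "insert b (Poly_Mapping.keys c)" C U] c b ne ch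
    by auto
  then show "int (ord b) dvd Poly_Mapping.lookup c b"
    using ind[of A] c1 by (auto simp: independent_def)
qed

text \<open>Zorn's lemma. This takes the place of choosing a complement of a subspace in the
  \<open>\<int>/p\<close>-vector space of elements that \<open>p\<close> kills.\<close>

lemma independent_extend_socle:
  assumes A: "independent A" and H: "H \<subseteq> carrier G" and p: "Factorial_Ring.prime p"
  obtains B where "A \<subseteq> B" "B \<subseteq> A \<union> {x\<in>H. ord x = p}" "independent B"
    "{x\<in>H. x [^] p = \<one>} \<subseteq> combinations B"
proof -
  define U where "U = {B. A \<subseteq> B \<and> B \<subseteq> A \<union> {x\<in>H. ord x = p} \<and> independent B}"
  have "\<exists>M\<in>U. \<forall>N\<in>U. M \<subseteq> N \<longrightarrow> N = M"
  proof (rule subset_Zorn_nonempty)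
    show "U \<noteq> {}" using A by (auto simp: U_def)
    fix C assume C: "C \<noteq> {}" "subset.chain U C"
    then have "C \<subseteq> U" by (simp add: subset.chain_def)
    then show "\<Union>C \<in> U"
      using independent_Union_chain[OF C] C(1) by (auto simp: U_def)
  qed
  then obtain B where B: "B \<in> U" and max: "\<And>N. N \<in> U \<Longrightarrow> B \<subseteq> N \<Longrightarrow> N = B" by blast
  have BG: "B \<subseteq> carrier G" using B by (auto simp: U_def independent_def)
  have "x \<in> combinations B" if x: "x \<in> H" "x [^] p = \<one>" for x
  proof (cases "x = \<one>")
    case True
    then show ?thesis by (auto intro: combinationsI[of 0])
  next
    case False
    have xG: "x \<in> carrier G" using x H by auto
    have "ord x dvd p" using x xG by (simp add: pow_eq_id)
    moreover have "ord x \<noteq> 1" using False xG ord_eq_1 by simp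
    ultimately have op: "ord x = p" using p by (metis prime_nat_iff)
    show ?thesis
    proof (rule ccontr)
      assume nx: "x \<notin> combinations B"
      have "independent (insert x B)"
        using B nx xG p op by (intro independent_insert_prime_order[of B x p]) (auto simp: U_def)
      then have "insert x B \<in> U"
        using B x op by (auto simp: U_def)
      then have "x \<in> B" using max by blast
      then show False using nx xG by (auto intro: combinationsI[of "frag_of x"])
    qed
  qed
  then have "{x\<in>H. x [^] p = \<one>} \<subseteq> combinations B" by blast
  with B show thesis by (intro that[of B]) (simp_all add: U_def)
qed

end

section \<open>Bases of bounded abelian groups\<close>

context comm_group
begin

lemma frag_eval_in_subgroup:
  assumes H: "subgroup H G" and c: "Poly_Mapping.keys c \<subseteq> H"
  shows "frag_eval c \<in> H"
proof -
  note HG = subgroup.subset[OF H]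
  have "Poly_Mapping.keys c \<subseteq> H \<and> frag_eval c \<in> H"
    using c
  proof (induction c rule: frag_induction)
    case zero
    then show ?case using H by (simp add: subgroup.one_closed)
  next
    case (one x)
    then show ?case using HG by (auto simp: subset_iff)
  next
    case (diff a b)
    have "Poly_Mapping.keys (a - b) \<subseteq> H" using diff.IH keys_diff[of a b] by (meson Un_least order_trans)
    moreover have "frag_eval (a - b) = frag_eval a \<otimes> inv frag_eval b"
      using diff HG by (intro frag_eval_diff) auto
    ultimately show ?case
      using diff H by (simp add: subgroup.m_closed subgroup.m_inv_closed)
  qed
  then show ?thesis ..
qed

lemma frag_eval_power:
  assumes "Poly_Mapping.keys c \<subseteq> carrier G"
  shows "frag_eval (frag_extend (frag_of \<circ> (\<lambda>b. b [^] (p::nat))) c) = frag_eval c [^] p"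
proof -
  have "Poly_Mapping.keys c \<subseteq> carrier G \<and>
    Poly_Mapping.keys (frag_extend (frag_of \<circ> (\<lambda>b. b [^] (p::nat))) c) \<subseteq> carrier G \<and>
    frag_eval (frag_extend (frag_of \<circ> (\<lambda>b. b [^] (p::nat))) c) = frag_eval c [^] p"
    using assms
  proof (induction c rule: frag_induction)
    case (diff a b)
    have "Poly_Mapping.keys (a - b) \<subseteq> carrier G" using diff.IH keys_diff[of a b] by (meson Un_least order_trans)
    moreover have "Poly_Mapping.keys (frag_extend (frag_of \<circ> (\<lambda>b. b [^] p)) (a - b)) \<subseteq> carrier G"
      using diff.IH keys_diff unfolding frag_extend_diff by (meson Un_least order_trans)
    moreover have "frag_eval (frag_extend (frag_of \<circ> (\<lambda>b. b [^] p)) (a - b)) = frag_eval (a - b) [^] p"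
      using diff by (simp add: o_def frag_extend_diff frag_eval_diff pow_mult_distrib m_comm nat_pow_inv)
    ultimately show ?case by (intro conjI)
  qed auto
  then show ?thesis by blast
qed

end

lemma lookup_frag_extend_inj:
  assumes "Poly_Mapping.keys c \<subseteq> S" "inj_on f S" "b \<in> S"
  shows "Poly_Mapping.lookup (frag_extend (frag_of \<circ> f) c) (f b) = Poly_Mapping.lookup c b"
  using assms(1)
proof (induction c rule: frag_induction)
  case (one x)
  then show ?case using assms(2,3) by (auto simp: inj_on_eq_iff)
next
  case (diff a b)
  then show ?case by (simp add: frag_extend_diff lookup_minus)
qed simp

context comm_group
begin

text \<open>Taking \<open>p\<close>-th roots preserves independence. Raising a relation between the roots to the power \<open>p\<close>
  shows that the order of \<open>h\<close> divides the coefficient of \<open>g h\<close>, which is enough if \<open>p\<close> does not divide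
  that order. If it does, then \<open>p\<close> divides the coefficient; after discarding the trivial terms, the
  whole relation is the \<open>p\<close>-th power of another combination \<open>e\<close>, and the same argument applied to
  \<open>e\<close> yields the missing factor \<open>p\<close>.\<close>

lemma independent_roots:
  assumes p: "Factorial_Ring.prime p" and A: "independent A"
    and g: "\<And>h. h \<in> A \<Longrightarrow> g h \<in> carrier G"
    and gp: "\<And>h. h \<in> A \<Longrightarrow> g h [^] p = h"
    and og: "\<And>h. h \<in> A \<Longrightarrow> ord (g h) = (if p dvd ord h then p * ord h else ord h)"
  shows "independent (g ` A)"
  unfolding independent_def
proof (intro conjI allI impI ballI)
  show BG: "g ` A \<subseteq> carrier G" using g by blast
  fix c b assume c: "Poly_Mapping.keys c \<subseteq> g ` A" and c1: "frag_eval c = \<one>" and b: "b \<in> g ` A"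
  let ?f = "\<lambda>b. b [^] p"
  have inj: "inj_on ?f (g ` A)" using gp by (auto simp: inj_on_def)
  have *: "int (ord h) dvd Poly_Mapping.lookup d (g h)"
    if d: "Poly_Mapping.keys d \<subseteq> g ` A" "frag_eval d [^] p = \<one>" and h: "h \<in> A" for d h
  proof -
    have "Poly_Mapping.keys (frag_extend (frag_of \<circ> ?f) d) \<subseteq> A"
      using keys_frag_extend[of "frag_of \<circ> ?f" d] d(1) gp by (fastforce simp: subset_iff)
    moreover have "frag_eval (frag_extend (frag_of \<circ> ?f) d) = \<one>"
      using frag_eval_power[of d p] d BG by auto
    ultimately have "int (ord h) dvd Poly_Mapping.lookup (frag_extend (frag_of \<circ> ?f) d) h"
      using A h by (auto simp: independent_def)
    then show ?thesis
      using lookup_frag_extend_inj[OF d(1) inj, of "g h"] h gp by simp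
  qed
  \<comment> \<open>\<open>c\<close> is \<open>p\<close> times \<open>e\<close> plus a combination \<open>r\<close> of trivial terms\<close>
  define e where "e = Poly_Mapping.mapp (\<lambda>b k. if p dvd ord (b [^] p) then k div int p else 0) c"
  have le: "Poly_Mapping.lookup e b = (if p dvd ord (b [^] p) then Poly_Mapping.lookup c b div int p else 0)" for b
    by (auto simp: e_def lookup_mapp in_keys_iff when_def)
  have ke: "Poly_Mapping.keys e \<subseteq> g ` A"
    using c by (auto simp: in_keys_iff le subset_iff split: if_splits) (metis div_0)
  define r where "r = c - frag_cmul (int p) e"
  have c_dvd: "int (ord h) dvd Poly_Mapping.lookup c (g h)" if "h \<in> A" for h
    using * [OF c _ that] c1 by simp
  have lr: "Poly_Mapping.lookup r (g h) = (if p dvd ord h then 0 else Poly_Mapping.lookup c (g h))"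
    if h: "h \<in> A" for h
  proof (cases "p dvd ord h")
    case True
    then have "int p dvd Poly_Mapping.lookup c (g h)"
      using c_dvd[OF h] by (meson dvd_trans of_nat_dvd_iff)
    then show ?thesis using True gp[OF h] by (simp add: r_def lookup_minus le)
  qed (use gp[OF h] in \<open>simp add: r_def lookup_minus le\<close>)
  have kr: "Poly_Mapping.keys r \<subseteq> g ` A"
    using c ke keys_cmul[of "int p" e] keys_diff[of c "frag_cmul (int p) e"] unfolding r_def by blast
  have "frag_eval r = \<one>"
  proof (rule frag_eval_trivial)
    show "Poly_Mapping.keys r \<subseteq> carrier G" using kr BG by blast
    fix b assume "b \<in> Poly_Mapping.keys r"
    then obtain h where "h \<in> A" "b = g h" using kr by blast
    then show "int (ord b) dvd Poly_Mapping.lookup r b"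
      using lr c_dvd og by auto
  qed
  moreover have "frag_eval r = frag_eval c \<otimes> inv (frag_eval e [^] p)"
    unfolding r_def using c ke BG keys_cmul[of "int p" e]
    by (subst frag_eval_diff) (auto simp: frag_eval_cmul int_pow_int)
  ultimately have e1: "frag_eval e [^] p = \<one>"
    using c1 ke BG by (simp add: inv_eq_1_iff subset_trans)
  obtain h where h: "h \<in> A" "b = g h" using b by blast
  show "int (ord b) dvd Poly_Mapping.lookup c b"
  proof (cases "p dvd ord h")
    case True
    have "int (ord h) dvd Poly_Mapping.lookup c b div int p"
      using *[OF ke e1 h(1)] h gp True by (simp add: le)
    moreover have "int p dvd Poly_Mapping.lookup c b"
      using True c_dvd[OF h(1)] h(2) by (meson dvd_trans of_nat_dvd_iff)
    ultimately show ?thesis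
      using True og h by (metis dvd_mult_div_cancel mult_dvd_mono dvd_refl of_nat_mult)
  next
    case False
    then show ?thesis using c_dvd og h by simp
  qed
qed

lemma subgroup_nat_pow_closed:
  "\<lbrakk>subgroup H G; h \<in> H\<rbrakk> \<Longrightarrow> h [^] (n::nat) \<in> H"
  using subgroup_int_pow_closed[of H h "int n"] by (simp add: int_pow_int)

text \<open>If \<open>p\<close> does not divide the order of a \<open>p\<close>-th power, then this power has another \<open>p\<close>-th root in the
  cyclic group that it generates. This choice keeps the orders in a basis prime powers even though
  the group need not be a \<open>p\<close>-group.\<close>

lemma prime_root_in_subgroup:
  assumes p: "Factorial_Ring.prime p" and H: "subgroup H G" and x: "x \<in> H"
  obtains g where "g \<in> H" "g [^] p = x [^] p"
    "ord g = (if p dvd ord (x [^] p) then p * ord (x [^] p) else ord (x [^] p))"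
proof -
  have xG: "x \<in> carrier G" using x subgroup.subset[OF H] by blast
  define h where "h = x [^] p"
  have hG: "h \<in> carrier G" using xG by (simp add: h_def)
  show thesis
  proof (cases "p dvd ord h")
    case True
    have "h [^] ord x = \<one>"
      unfolding h_def using xG by (metis nat_pow_one nat_pow_pow mult.commute pow_ord_eq_1)
    then have "ord h dvd ord x" using hG by (simp add: pow_eq_id)
    then have px: "p dvd ord x" using True dvd_trans by blast
    then have "ord h = ord x div p"
      unfolding h_def using xG p by (intro ord_pow) auto
    then show ?thesis
      using that[of x] x True px by (simp add: h_def)
  next
    case False
    then have "coprime (int p) (int (ord h))"
      using p by (intro prime_imp_coprime) auto
    then obtain u v where uv: "u * int p + v * int (ord h) = 1"
      using bezout_int[of "int p" "int (ord h)"] by auto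
    define g where "g = h [^] u"
    have hH: "h \<in> H" using x H by (simp add: h_def subgroup_nat_pow_closed)
    have gH: "g \<in> H" using hH H by (simp add: g_def subgroup_int_pow_closed)
    have gG: "g \<in> carrier G" using hG by (simp add: g_def)
    have "h = h [^] (u * int p + v * int (ord h))" using uv hG by simp
    also have "\<dots> = h [^] (u * int p) \<otimes> h [^] (v * int (ord h))"
      using hG by (simp add: int_pow_mult)
    also have "h [^] (v * int (ord h)) = \<one>" using hG by (simp add: int_pow_eq_id)
    also have "h [^] (u * int p) = g [^] p"
      using hG by (simp add: g_def int_pow_pow flip: int_pow_int)
    finally have gp: "g [^] p = h" using gG by simp
    have "ord g dvd ord h"
      using gG hG by (simp add: g_def int_pow_eq_id int_pow_pow flip: pow_eq_id int_pow_int)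
    moreover have "ord h dvd ord g"
      using gG gp by (metis nat_pow_one nat_pow_pow mult.commute pow_ord_eq_1 pow_eq_id hG)
    ultimately have "ord g = ord h" by (rule dvd_antisym)
    then show ?thesis using that[of g] gH gp False by (simp add: h_def)
  qed
qed

lemma combinations_mult:
  assumes "A \<subseteq> carrier G" "x \<in> combinations A" "y \<in> combinations A"
  shows "x \<otimes> y \<in> combinations A"
proof -
  obtain c d where "Poly_Mapping.keys c \<subseteq> A" "frag_eval c = x" "Poly_Mapping.keys d \<subseteq> A" "frag_eval d = y"
    using assms by (meson combinationsE)
  then show ?thesis
    using assms(1) keys_add[of c d] by (intro combinationsI[of "c + d"]) (auto simp: frag_eval_add)
qed

text \<open>The theorem of Pruefer and Baer, by induction on the exponent. For a prime \<open>p\<close> dividing the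
  exponent, the \<open>p\<close>-th powers form a subgroup of smaller exponent, which has a basis. Roots of that basis
  are independent, and modulo their combinations every element is killed by \<open>p\<close>; so it suffices to
  add elements of order \<open>p\<close>.\<close>

theorem bounded_subgroup_has_basis:
  assumes "m > 0" "subgroup H G" "\<And>x. x \<in> H \<Longrightarrow> x [^] (m::nat) = \<one>"
  shows "\<exists>B. B \<subseteq> H \<and> independent B \<and> H \<subseteq> combinations B \<and>
    (\<forall>b\<in>B. \<exists>p k. Factorial_Ring.prime p \<and> 0 < k \<and> ord b = p ^ k)"
  using assms
proof (induction m arbitrary: H rule: less_induct)
  case (less m)
  note H = less.prems(2)
  note HG = subgroup.subset[OF H]
  show ?case
  proof (cases "m = 1")
    case True
    then have "H \<subseteq> {\<one>}" using less.prems(3) HG by fastforce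
    moreover have "\<one> \<in> combinations {}" by (rule combinationsI[of 0]) auto
    ultimately show ?thesis by (intro exI[of _ "{}"]) (auto simp: independent_def)
  next
    case False
    then obtain p where p: "Factorial_Ring.prime p" "p dvd m"
      using prime_factor_nat by blast
    then obtain m' where m': "m = p * m'" by blast
    define P where "P = (\<lambda>x. x [^] p) ` H"
    have P: "subgroup P G"
    proof (rule subgroupI)
      show "P \<subseteq> carrier G" using HG by (auto simp: P_def)
      show "P \<noteq> {}" using subgroup.one_closed[OF H] by (auto simp: P_def)
      fix a assume "a \<in> P"
      then obtain x where x: "x \<in> H" "a = x [^] p" by (auto simp: P_def)
      then have "inv a = (inv x) [^] p" using HG by (auto simp: nat_pow_inv)
      then show "inv a \<in> P" using x H by (auto simp: P_def subgroup.m_inv_closed)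
      fix b assume "b \<in> P"
      then obtain y where y: "y \<in> H" "b = y [^] p" by (auto simp: P_def)
      have "a \<otimes> b = (x \<otimes> y) [^] p" using x y HG by (auto simp: pow_mult_distrib m_comm subset_iff)
      then show "a \<otimes> b \<in> P" using x y H by (auto simp: P_def subgroup.m_closed)
    qed
    have "P \<subseteq> H" using H by (auto simp: P_def subgroup_nat_pow_closed)
    have "m' > 0" "m' < m" using m' less.prems(1) p(1) prime_gt_1_nat by auto
    moreover have "x [^] m' = \<one>" if "x \<in> P" for x
      using that less.prems(3) HG m' by (auto simp: P_def nat_pow_pow)
    ultimately obtain A where A: "A \<subseteq> P" "independent A" "P \<subseteq> combinations A"
      and Apk: "\<forall>b\<in>A. \<exists>p k. Factorial_Ring.prime p \<and> 0 < k \<and> ord b = p ^ k"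
      using less.IH[of m' P] P by blast
    have "\<forall>h\<in>A. \<exists>g\<in>H. g [^] p = h \<and> ord g = (if p dvd ord h then p * ord h else ord h)"
    proof
      fix h assume "h \<in> A"
      then obtain x where x: "x \<in> H" "h = x [^] p" using A(1) by (auto simp: P_def)
      show "\<exists>g\<in>H. g [^] p = h \<and> ord g = (if p dvd ord h then p * ord h else ord h)"
        using prime_root_in_subgroup[OF p(1) H x(1)] x(2) by metis
    qed
    then obtain g where g: "\<And>h. h \<in> A \<Longrightarrow> g h \<in> H" "\<And>h. h \<in> A \<Longrightarrow> g h [^] p = h"
      "\<And>h. h \<in> A \<Longrightarrow> ord (g h) = (if p dvd ord h then p * ord h else ord h)"
      by metis
    have "independent (g ` A)"
      using g HG by (intro independent_roots[OF p(1) A(2)]) auto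
    then obtain B where B: "g ` A \<subseteq> B" "B \<subseteq> g ` A \<union> {x \<in> H. ord x = p}" "independent B"
      "{x \<in> H. x [^] p = \<one>} \<subseteq> combinations B"
      using independent_extend_socle[OF _ HG p(1)] by blast
    have BG: "B \<subseteq> carrier G" using B(3) by (simp add: independent_def)
    have "H \<subseteq> combinations B"
    proof
      fix x assume x: "x \<in> H"
      then have "x [^] p \<in> combinations A" using A(3) by (auto simp: P_def)
      then obtain a where a: "Poly_Mapping.keys a \<subseteq> A" "frag_eval a = x [^] p"
        by (rule combinationsE)
      define d where "d = frag_extend (frag_of \<circ> g) a"
      have d: "Poly_Mapping.keys d \<subseteq> g ` A"
        using keys_frag_extend[of "frag_of \<circ> g" a] a(1) by (fastforce simp: d_def subset_iff)
      have dH: "frag_eval d \<in> H" using d g by (intro frag_eval_in_subgroup[OF H]) auto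
      have "frag_eval d [^] p = frag_eval (frag_extend (frag_of \<circ> (\<lambda>b. b [^] p)) d)"
        using d g(1) HG by (intro frag_eval_power[symmetric]) blast
      also have "frag_extend (frag_of \<circ> (\<lambda>b. b [^] p)) d = frag_extend ((frag_of \<circ> (\<lambda>b. b [^] p)) \<circ> g) a"
        by (simp add: d_def frag_extend_compose)
      also have "\<dots> = frag_extend frag_of a"
        using a(1) g(2) by (intro frag_extend_eq) (auto simp: subset_iff)
      also have "\<dots> = a" by (simp flip: frag_expansion)
      finally have dp: "frag_eval d [^] p = x [^] p" using a by simp
      define y where "y = x \<otimes> inv (frag_eval d)"
      have "y \<in> H" using x dH H by (simp add: y_def subgroup.m_closed subgroup.m_inv_closed)
      moreover have "y [^] p = \<one>"
        using x dH HG dp by (simp add: y_def pow_mult_distrib m_comm nat_pow_inv subset_iff)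
      ultimately have "y \<in> combinations B" using B(4) by blast
      moreover have "frag_eval d \<in> combinations B"
        using d B(1) by (intro combinationsI[of d]) auto
      moreover have "x = y \<otimes> frag_eval d"
        using x dH HG by (simp add: y_def m_assoc subset_iff)
      ultimately show "x \<in> combinations B"
        using combinations_mult[OF BG] by blast
    qed
    moreover have "B \<subseteq> H" using B(2) g(1) by auto
    moreover have "\<exists>q k. Factorial_Ring.prime q \<and> 0 < k \<and> ord b = q ^ k" if "b \<in> B" for b
    proof (cases "b \<in> g ` A")
      case True
      then obtain h where h: "h \<in> A" "b = g h" by blast
      obtain q k where q: "Factorial_Ring.prime q" "0 < k" "ord h = q ^ k" using Apk h by blast
      show ?thesis
      proof (cases "p dvd ord h")
        case True
        then have "p = q" using q p(1) by (metis prime_dvd_power primes_dvd_imp_eq)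
        then have "ord b = q ^ Suc k" using h g(3) True q by simp
        then show ?thesis using q by blast
      qed (use h g(3) q in auto)
    next
      case False
      then have "ord b = p ^ 1" using that B(2) by auto
      then show ?thesis using p(1) by blast
    qed
    ultimately show ?thesis using B(3) by blast
  qed
qed

end

section \<open>From a basis to a cyclic decomposition\<close>

text \<open>The two outer sums are over finite index sets, so only the innermost one restricts the support.\<close>

lemma carrier_cyclic_sum:
  assumes M: "finite M" and pos: "\<And>p. p \<in> M \<Longrightarrow> 0 < p"
  shows "f \<in> carrier (sum_group M (\<lambda>p. sum_group {1..n p} (\<lambda>i.
            sum_group (K i p) (\<lambda>_. integer_mod_group (p ^ i))))) \<longleftrightarrow>
    f \<in> extensional M \<and> (\<forall>p\<in>M. f p \<in> extensional {1..n p} \<and>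
      (\<forall>i\<in>{1..n p}. f p i \<in> extensional (K i p) \<and>
        (\<forall>b\<in>K i p. f p i b \<in> {0..<int (p ^ i)}) \<and> finite {b\<in>K i p. f p i b \<noteq> 0}))"
proof -
  have "carrier (integer_mod_group (p ^ i)) = {0..<int (p ^ i)}" if "p \<in> M" for p i
    using pos[OF that] by (simp add: carrier_integer_mod_group)
  then show ?thesis
    using M by (auto simp: carrier_sum_group PiE_iff)
qed

context comm_group
begin

definition coords :: "'a set \<Rightarrow> 'a \<Rightarrow> 'a \<Rightarrow>\<^sub>0 int" where
  "coords B x = (SOME c. Poly_Mapping.keys c \<subseteq> B \<and> frag_eval c = x)"

lemma coords:
  assumes "x \<in> combinations B"
  shows "Poly_Mapping.keys (coords B x) \<subseteq> B" "frag_eval (coords B x) = x"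
proof -
  have "\<exists>c. Poly_Mapping.keys c \<subseteq> B \<and> frag_eval c = x"
    using assms by (meson combinationsE)
  from someI_ex[OF this]
  show "Poly_Mapping.keys (coords B x) \<subseteq> B" "frag_eval (coords B x) = x"
    by (simp_all add: coords_def)
qed

lemma frag_eval_eq_iff:
  assumes B: "independent B" and c: "Poly_Mapping.keys c \<subseteq> B" and d: "Poly_Mapping.keys d \<subseteq> B"
  shows "frag_eval c = frag_eval d \<longleftrightarrow>
    (\<forall>b\<in>B. int (ord b) dvd Poly_Mapping.lookup c b - Poly_Mapping.lookup d b)"
proof -
  have BG: "B \<subseteq> carrier G" using B by (simp add: independent_def)
  have cd: "Poly_Mapping.keys c \<subseteq> carrier G" "Poly_Mapping.keys d \<subseteq> carrier G"
    using c d BG by auto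
  have k: "Poly_Mapping.keys (c - d) \<subseteq> B" using c d keys_diff[of c d] by blast
  have "frag_eval c = frag_eval d \<longleftrightarrow> frag_eval (c - d) = \<one>"
    using cd by (simp add: frag_eval_diff) (metis frag_eval_closed inv_closed inv_equality inv_inv r_inv)
  also have "\<dots> \<longleftrightarrow> (\<forall>b\<in>B. int (ord b) dvd Poly_Mapping.lookup (c - d) b)"
  proof
    show "frag_eval (c - d) = \<one> \<Longrightarrow> \<forall>b\<in>B. int (ord b) dvd Poly_Mapping.lookup (c - d) b"
      using B k by (simp add: independent_def)
    show "\<forall>b\<in>B. int (ord b) dvd Poly_Mapping.lookup (c - d) b \<Longrightarrow> frag_eval (c - d) = \<one>"
      using k BG by (intro frag_eval_trivial) auto
  qed
  finally show ?thesis by (simp add: lookup_minus)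
qed

text \<open>A chosen combination representing \<open>x\<close> is not additive in \<open>x\<close>, but its coefficients are additive
  modulo the orders of the basis elements.\<close>

lemma coords_mult:
  assumes B: "independent B" and x: "x \<in> combinations B" and y: "y \<in> combinations B" and b: "b \<in> B"
  shows "int (ord b) dvd Poly_Mapping.lookup (coords B (x \<otimes> y)) b
    - (Poly_Mapping.lookup (coords B x) b + Poly_Mapping.lookup (coords B y) b)"
proof -
  have BG: "B \<subseteq> carrier G" using B by (simp add: independent_def)
  have xy: "x \<otimes> y \<in> combinations B" using combinations_mult BG x y by blast
  have "Poly_Mapping.keys (coords B x + coords B y) \<subseteq> B"
    using keys_add[of "coords B x" "coords B y"] coords(1)[OF x] coords(1)[OF y] by blast
  moreover have "frag_eval (coords B (x \<otimes> y)) = frag_eval (coords B x + coords B y)"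
    using coords[OF x] coords[OF y] coords[OF xy] BG by (simp add: frag_eval_add subset_trans)
  ultimately show ?thesis
    using frag_eval_eq_iff[OF B coords(1)[OF xy]] b by (simp add: lookup_add)
qed

theorem basis_cyclic_decomposition:
  assumes B: "independent B" and gen: "carrier G \<subseteq> combinations B"
    and M: "finite M" "\<And>p. p \<in> M \<Longrightarrow> Factorial_Ring.prime p \<and> 1 \<le> n p"
    and top: "\<And>p. p \<in> M \<Longrightarrow> \<exists>b\<in>B. ord b = p ^ n p"
    and cov: "\<And>b. b \<in> B \<Longrightarrow> \<exists>p\<in>M. \<exists>i\<in>{1..n p}. ord b = p ^ i"
  shows "cyclic_decomposition G M n (\<lambda>i p. {b\<in>B. ord b = p ^ i})"
proof -
  define K where "K = (\<lambda>i p. {b\<in>B. ord b = p ^ i})"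
  define S where "S = sum_group M (\<lambda>p. sum_group {1..n p} (\<lambda>i.
            sum_group (K i p) (\<lambda>_. integer_mod_group (p ^ i))))"
  define \<theta> where "\<theta> = (\<lambda>x. \<lambda>p\<in>M. \<lambda>i\<in>{1..n p}. \<lambda>b\<in>K i p.
     Poly_Mapping.lookup (coords B x) b mod int (p ^ i))"
  have BG: "B \<subseteq> carrier G" using B by (simp add: independent_def)
  have pos: "0 < p" if "p \<in> M" for p using M(2)[OF that] prime_gt_0_nat by simp
  have carS: "f \<in> carrier S \<longleftrightarrow> f \<in> extensional M \<and> (\<forall>p\<in>M. f p \<in> extensional {1..n p} \<and>
      (\<forall>i\<in>{1..n p}. f p i \<in> extensional (K i p) \<and>
        (\<forall>b\<in>K i p. f p i b \<in> {0..<int (p ^ i)}) \<and> finite {b\<in>K i p. f p i b \<noteq> 0}))" for f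
    unfolding S_def by (rule carrier_cyclic_sum[OF M(1) pos])
  have "\<theta> \<in> iso G S"
  proof (rule isoI)
    show "\<theta> \<in> hom G S"
    proof (rule homI)
      fix x assume x: "x \<in> carrier G"
      have "finite {b \<in> K i p. Poly_Mapping.lookup (coords B x) b mod int (p ^ i) \<noteq> 0}" for i p
        by (rule finite_subset[OF _ finite_keys[of "coords B x"]]) (auto simp: in_keys_iff)
      then show "\<theta> x \<in> carrier S"
        using pos unfolding carS by (auto simp: \<theta>_def cong: conj_cong)
    next
      fix x y assume xy: "x \<in> carrier G" "y \<in> carrier G"
      have "Poly_Mapping.lookup (coords B (x \<otimes> y)) b mod int (p ^ i) =
        (Poly_Mapping.lookup (coords B x) b + Poly_Mapping.lookup (coords B y) b) mod int (p ^ i)"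
        if "b \<in> K i p" for b p i
        using coords_mult[OF B, of x y b] that xy gen by (auto simp: K_def mod_eq_dvd_iff)
      then show "\<theta> (x \<otimes> y) = \<theta> x \<otimes>\<^bsub>S\<^esub> \<theta> y"
        by (simp add: \<theta>_def S_def mod_add_eq cong: restrict_cong)
    qed
    show "bij_betw \<theta> (carrier G) (carrier S)"
    proof (rule bij_betw_imageI)
      show "inj_on \<theta> (carrier G)"
      proof (rule inj_onI)
        fix x y assume xy: "x \<in> carrier G" "y \<in> carrier G" and eq: "\<theta> x = \<theta> y"
        have x: "x \<in> combinations B" and y: "y \<in> combinations B" using xy gen by auto
        have "int (ord b) dvd Poly_Mapping.lookup (coords B x) b - Poly_Mapping.lookup (coords B y) b"
          if b: "b \<in> B" for b
        proof -
          obtain p i where pi: "p \<in> M" "i \<in> {1..n p}" "ord b = p ^ i" using cov b by blast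
          have "\<theta> x p i b = \<theta> y p i b" using eq by simp
          then show ?thesis using pi b by (simp add: \<theta>_def K_def mod_eq_dvd_iff)
        qed
        then have "frag_eval (coords B x) = frag_eval (coords B y)"
          using frag_eval_eq_iff[OF B coords(1)[OF x] coords(1)[OF y]] by blast
        then show "x = y" using coords(2)[OF x] coords(2)[OF y] by simp
      qed
      show "\<theta> ` carrier G = carrier S"
      proof
        show "\<theta> ` carrier G \<subseteq> carrier S" using \<open>\<theta> \<in> hom G S\<close> by (auto simp: hom_def)
        show "carrier S \<subseteq> \<theta> ` carrier G"
        proof
          fix f assume f: "f \<in> carrier S"
          have "\<forall>b\<in>B. \<exists>q. fst q \<in> M \<and> snd q \<in> {1..n (fst q)} \<and> ord b = fst q ^ snd q"
            using cov by fastforce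
          then obtain q where q: "\<And>b. b \<in> B \<Longrightarrow> fst (q b) \<in> M \<and> snd (q b) \<in> {1..n (fst (q b))} \<and> ord b = fst (q b) ^ snd (q b)"
            by metis
          have uni: "q b = (p, i)" if "b \<in> K i p" "p \<in> M" "i \<in> {1..n p}" for b p i
          proof -
            have b: "b \<in> B" "ord b = p ^ i" using that by (auto simp: K_def)
            have "fst (q b) = p" "snd (q b) = i"
              using q[OF b(1)] b(2) M(2) that prime_power_inj'[of "fst (q b)" p "snd (q b)" i] by auto
            then show ?thesis by (metis prod.collapse)
          qed
          define \<phi> where "\<phi> = (\<lambda>b. if b \<in> B then f (fst (q b)) (snd (q b)) b else 0)"
          have "{b. \<phi> b \<noteq> 0} \<subseteq> (\<Union>p\<in>M. \<Union>i\<in>{1..n p}. {b\<in>K i p. f p i b \<noteq> 0})"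
            using q by (fastforce simp: \<phi>_def K_def split: if_splits)
          moreover have "finite (\<Union>p\<in>M. \<Union>i\<in>{1..n p}. {b\<in>K i p. f p i b \<noteq> 0})"
            using f M(1) unfolding carS by auto
          ultimately have fin: "finite {b. \<phi> b \<noteq> 0}" by (rule finite_subset)
          define c where "c = Abs_poly_mapping \<phi>"
          have "Poly_Mapping.lookup c = \<phi>"
            using fin by (simp add: c_def Abs_poly_mapping_inverse)
          then have lc: "Poly_Mapping.lookup c = (\<lambda>b. if b \<in> B then f (fst (q b)) (snd (q b)) b else 0)"
            by (simp add: \<phi>_def)
          have kc: "Poly_Mapping.keys c \<subseteq> B" by (auto simp: in_keys_iff lc split: if_splits)
          define x where "x = frag_eval c"
          have xG: "x \<in> carrier G" using kc BG by (simp add: x_def subset_trans)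
          then have x: "x \<in> combinations B" using gen by blast
          have *: "Poly_Mapping.lookup (coords B x) b mod int (p ^ i) = f p i b"
            if pi: "p \<in> M" "i \<in> {1..n p}" and b: "b \<in> K i p" for p i b
          proof -
            have "b \<in> B" "ord b = p ^ i" using b by (auto simp: K_def)
            then have "int (p ^ i) dvd Poly_Mapping.lookup (coords B x) b - Poly_Mapping.lookup c b"
              using frag_eval_eq_iff[OF B coords(1)[OF x] kc] coords(2)[OF x]
              unfolding x_def by metis
            then have "Poly_Mapping.lookup (coords B x) b mod int (p ^ i) = Poly_Mapping.lookup c b mod int (p ^ i)"
              by (simp only: mod_eq_dvd_iff)
            also have "Poly_Mapping.lookup c b = f p i b" using b uni[OF b pi] by (simp add: lc K_def)
            also have "f p i b mod int (p ^ i) = f p i b"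
              using f pi b unfolding carS by (intro mod_pos_pos_trivial) auto
            finally show ?thesis .
          qed
          have "\<theta> x = f"
          proof
            fix p show "\<theta> x p = f p"
            proof (cases "p \<in> M")
              case p: True
              show ?thesis
              proof
                fix i show "\<theta> x p i = f p i"
                proof (cases "i \<in> {1..n p}")
                  case i: True
                  then have "f p i \<in> extensional (K i p)" using f p unfolding carS by blast
                  then show ?thesis
                    using * p i by (auto simp: \<theta>_def extensional_def)
                next
                  case False
                  moreover have "f p \<in> extensional {1..n p}" using f p unfolding carS by blast
                  ultimately show ?thesis using p by (auto simp: \<theta>_def extensional_def)
                qed
              qed
            next
              case False
              moreover have "f \<in> extensional M" using f unfolding carS by blast
              ultimately show ?thesis by (auto simp: \<theta>_def extensional_def)
            qed
          qed
          then show "f \<in> \<theta> ` carrier G" using xG by blast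
        qed
      qed
    qed
  qed
  then have "G \<cong> S" by (auto simp: is_iso_def)
  then show ?thesis
    using M top unfolding cyclic_decomposition_def S_def K_def by auto
qed

end

section \<open>A finite leading invariant yields a continuous character\<close>

lemma cis_cong:
  assumes "int p dvd a - b" "p > 0"
  shows "cis (2 * pi * real_of_int a / real p) = cis (2 * pi * real_of_int b / real p)"
proof -
  obtain k where "a - b = int p * k" using assms by blast
  then have "real_of_int a = real_of_int b + real p * real_of_int k"
    by (metis add.commute diff_add_cancel of_int_add of_int_mult of_int_of_nat_eq)
  then have "2 * pi * real_of_int a / real p = 2 * pi * real_of_int b / real p + 2 * pi * real_of_int k"
    using assms(2) by (simp add: field_simps)
  then show ?thesis by (simp flip: cis_mult)
qed

lemma cis_primitive_root_neq_1:
  assumes "p > (1::nat)"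
  shows "cis (2 * pi / real p) \<noteq> 1"
proof
  assume "cis (2 * pi / real p) = 1"
  then have "cos (2 * pi / real p) = 1" by (simp add: complex_eq_iff)
  then obtain k :: int where "2 * pi / real p = real_of_int k * 2 * pi" by (auto simp: cos_one_2pi_int)
  then have "1 = real_of_int (k * int p)" using assms by (simp add: field_simps)
  then have "k * int p = 1" by linarith
  then show False using assms by (metis dvd_triv_right int_dvd_int_iff nat_dvd_1_iff_1 nat_neq_iff of_nat_1)
qed

lemma continuous_map_group_power:
  assumes "group G" "group_topology G T"
  shows "continuous_map T T (\<lambda>x. x [^]\<^bsub>G\<^esub> (m::nat))"
proof -
  interpret group G by fact
  have T: "topspace T = carrier G"
    and mult: "continuous_map (prod_topology T T) T (\<lambda>(x, y). x \<otimes>\<^bsub>G\<^esub> y)"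
    using assms(2) by (auto simp: group_topology_def)
  show ?thesis
  proof (induction m)
    case 0
    then show ?case using T by (simp add: continuous_map_const)
  next
    case (Suc m)
    have "continuous_map T (prod_topology T T) (\<lambda>x. (x [^]\<^bsub>G\<^esub> m, x))"
      using Suc by (intro continuous_map_pairedI) auto
    from continuous_map_compose[OF this mult] show ?case
      by (simp add: o_def)
  qed
qed

text \<open>In a Hausdorff group whose set of \<open>m\<close>-th powers is finite, that set is discrete. So the
  continuous map \<open>x \<mapsto> x\<^sup>m\<close> is locally constant.\<close>

lemma openin_power_fibre:
  assumes G: "group G" and T: "group_topology G T" and haus: "Hausdorff_space T"
    and fin: "finite ((\<lambda>x. x [^]\<^bsub>G\<^esub> (m::nat)) ` carrier G)"
  shows "openin T {x \<in> topspace T. x [^]\<^bsub>G\<^esub> m = y}"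
proof -
  interpret group G by fact
  let ?F = "(\<lambda>x. x [^]\<^bsub>G\<^esub> m) ` carrier G - {y}"
  have top: "topspace T = carrier G" using T by (simp add: group_topology_def)
  have "closedin T ?F"
    using fin top by (intro closedin_Hausdorff_finite[OF haus]) auto
  then have "closedin T {x \<in> topspace T. x [^]\<^bsub>G\<^esub> m \<in> ?F}"
    by (rule closedin_continuous_map_preimage[OF continuous_map_group_power[OF G T]])
  moreover have "{x \<in> topspace T. x [^]\<^bsub>G\<^esub> m = y} = topspace T - {x \<in> topspace T. x [^]\<^bsub>G\<^esub> m \<in> ?F}"
    using top by auto
  ultimately show ?thesis by (simp add: closedin_def)
qed

lemma continuous_map_factor_power:
  assumes "group G" "group_topology G T" "Hausdorff_space T"
    and "finite ((\<lambda>x. x [^]\<^bsub>G\<^esub> (m::nat)) ` carrier G)"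
    and fac: "\<And>x y. \<lbrakk>x \<in> carrier G; y \<in> carrier G; x [^]\<^bsub>G\<^esub> m = y [^]\<^bsub>G\<^esub> m\<rbrakk> \<Longrightarrow> \<xi> x = \<xi> y"
  shows "continuous_map T euclidean \<xi>"
proof -
  have top: "topspace T = carrier G" using assms(2) by (simp add: group_topology_def)
  have "openin T {x \<in> topspace T. \<xi> x \<in> U}" for U
  proof -
    have "{x \<in> topspace T. \<xi> x \<in> U} =
      (\<Union>z\<in>{z\<in>topspace T. \<xi> z \<in> U}. {x \<in> topspace T. x [^]\<^bsub>G\<^esub> m = z [^]\<^bsub>G\<^esub> m})"
    proof (intro equalityI subsetI)
      fix x assume "x \<in> (\<Union>z\<in>{z\<in>topspace T. \<xi> z \<in> U}. {x \<in> topspace T. x [^]\<^bsub>G\<^esub> m = z [^]\<^bsub>G\<^esub> m})"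
      then obtain z where "z \<in> carrier G" "\<xi> z \<in> U" "x \<in> carrier G" "x [^]\<^bsub>G\<^esub> m = z [^]\<^bsub>G\<^esub> m"
        using top by blast
      then show "x \<in> {x \<in> topspace T. \<xi> x \<in> U}" using fac[of x z] top by simp
    qed blast
    also have "openin T \<dots>" by (intro openin_Union) (auto intro: openin_power_fibre[OF assms(1-4)])
    finally show ?thesis .
  qed
  then show ?thesis by (simp add: continuous_map_def)
qed

text \<open>The number \<open>m\<close> is the exponent of the group divided by \<open>p\<close>. The power map \<open>x \<mapsto> x\<^sup>m\<close> is trivial on
  every summand except those of order \<open>p ^ n p\<close>, and there it remembers only the coordinate modulo \<open>p\<close>. As there are finitely
  many such summands, the image is finite, and the character \<open>\<xi>\<close> reading off one coordinate modulo \<open>p\<close>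
  factors through the locally constant map \<open>x \<mapsto> x\<^sup>m\<close>.\<close>

theorem not_minimally_almost_periodic:
  fixes G :: "('a, 'b) monoid_scheme"
  assumes G: "comm_group G" and cd: "cyclic_decomposition G M n K" and p: "p \<in> M"
    and finK: "finite (K (n p) p)" and T: "group_topology G T" and haus: "Hausdorff_space T"
  shows "\<not> minimally_almost_periodic G T"
proof
  interpret comm_group G by fact
  have grpG: "group G" by unfold_locales
  define S where "S = sum_group M (\<lambda>p. sum_group {1..n p} (\<lambda>i.
            sum_group (K i p) (\<lambda>_. integer_mod_group (p ^ i))))"
  have M: "finite M" "\<And>q. q \<in> M \<Longrightarrow> Factorial_Ring.prime q" "\<And>q. q \<in> M \<Longrightarrow> 1 \<le> n q" "\<And>q. q \<in> M \<Longrightarrow> K (n q) q \<noteq> {}"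
    and "G \<cong> S"
    using cd by (auto simp: cyclic_decomposition_def S_def)
  then obtain \<theta> where \<theta>: "\<theta> \<in> iso G S" by (auto simp: is_iso_def)
  have pos: "0 < q" if "q \<in> M" for q using M(2)[OF that] prime_gt_0_nat by simp
  have carS: "f \<in> carrier S \<longleftrightarrow> f \<in> extensional M \<and> (\<forall>p\<in>M. f p \<in> extensional {1..n p} \<and>
      (\<forall>i\<in>{1..n p}. f p i \<in> extensional (K i p) \<and>
        (\<forall>b\<in>K i p. f p i b \<in> {0..<int (p ^ i)}) \<and> finite {b\<in>K i p. f p i b \<noteq> 0}))" for f
    unfolding S_def by (rule carrier_cyclic_sum[OF M(1) pos])
  have \<theta>S: "\<theta> x \<in> carrier S" if "x \<in> carrier G" for x
    using \<theta> that by (auto simp: iso_def hom_def)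
  have \<theta>mult: "\<theta> (x \<otimes>\<^bsub>G\<^esub> y) q i b = (\<theta> x q i b + \<theta> y q i b) mod int (q ^ i)"
    if "x \<in> carrier G" "y \<in> carrier G" "q \<in> M" "i \<in> {1..n q}" "b \<in> K i q" for x y q i b
  proof -
    have "\<theta> (x \<otimes>\<^bsub>G\<^esub> y) = \<theta> x \<otimes>\<^bsub>S\<^esub> \<theta> y" using \<theta> that by (auto simp: iso_def hom_def)
    then show ?thesis using that by (simp add: S_def)
  qed
  have grpS: "group S" by (simp add: S_def)
  have \<theta>1: "\<theta> \<one>\<^bsub>G\<^esub> q i b = 0" if "q \<in> M" "i \<in> {1..n q}" "b \<in> K i q" for q i b
  proof -
    have "\<theta> \<one>\<^bsub>G\<^esub> = \<one>\<^bsub>S\<^esub>" using \<theta> hom_one[OF _ grpG grpS] by (auto simp: iso_def)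
    then show ?thesis using that by (simp add: S_def)
  qed
  have \<theta>pow: "\<theta> (x [^]\<^bsub>G\<^esub> k) q i b = (int k * \<theta> x q i b) mod int (q ^ i)"
    if "x \<in> carrier G" "q \<in> M" "i \<in> {1..n q}" "b \<in> K i q" for x k q i b
  proof (induction k)
    case 0
    then show ?case using \<theta>1 that by simp
  next
    case (Suc k)
    have "\<theta> (x [^]\<^bsub>G\<^esub> Suc k) q i b = (int k * \<theta> x q i b mod int (q ^ i) + \<theta> x q i b) mod int (q ^ i)"
      using that Suc by (simp add: \<theta>mult)
    also have "\<dots> = (int (Suc k) * \<theta> x q i b) mod int (q ^ i)"
      by (subst mod_add_left_eq) (simp add: algebra_simps)
    finally show ?case .
  qed
  have np: "1 \<le> n p" "n p \<in> {1..n p}" using M(3) p by auto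
  have primep: "Factorial_Ring.prime p" using M(2) p .
  have p1: "1 < p" using primep prime_gt_1_nat by simp
  obtain j where j: "j \<in> K (n p) p" using M(4) p by blast
  define r where "r = (\<Prod>q\<in>M - {p}. q ^ n q)"
  define m where "m = p ^ (n p - 1) * r"
  have cop: "coprime p r"
    unfolding r_def using primep M(2)
    by (intro prod_coprime_right) (auto intro!: primes_coprime)
  define \<xi> where "\<xi> = (\<lambda>x. cis (2 * pi * real_of_int (\<theta> x p (n p) j) / real p))"
  have fac: "\<xi> x = \<xi> y"
    if xy: "x \<in> carrier G" "y \<in> carrier G" and eq: "x [^]\<^bsub>G\<^esub> m = y [^]\<^bsub>G\<^esub> m" for x y
  proof -
    have "\<theta> (x [^]\<^bsub>G\<^esub> m) p (n p) j = \<theta> (y [^]\<^bsub>G\<^esub> m) p (n p) j" using eq by simp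
    then have "(int m * \<theta> x p (n p) j) mod int (p ^ n p) = (int m * \<theta> y p (n p) j) mod int (p ^ n p)"
      using \<theta>pow xy p np j by simp
    then have "int (p ^ n p) dvd int m * \<theta> x p (n p) j - int m * \<theta> y p (n p) j"
      by (simp only: mod_eq_dvd_iff)
    moreover have "int (p ^ n p) = int (p ^ (n p - 1)) * int p"
      using np by (metis One_nat_def Suc_pred less_eq_Suc_le of_nat_mult power_Suc2)
    ultimately have "int (p ^ (n p - 1)) * int p dvd int (p ^ (n p - 1)) * (int r * (\<theta> x p (n p) j - \<theta> y p (n p) j))"
      by (simp add: m_def algebra_simps)
    then have "int p dvd int r * (\<theta> x p (n p) j - \<theta> y p (n p) j)"
      using p1 by simp
    then have "int p dvd \<theta> x p (n p) j - \<theta> y p (n p) j"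
      using cop by (simp add: coprime_dvd_mult_right_iff)
    then show ?thesis unfolding \<xi>_def using p1 by (intro cis_cong) auto
  qed
  have fin: "finite ((\<lambda>x. x [^]\<^bsub>G\<^esub> m) ` carrier G)"
  proof -
    define \<psi> where "\<psi> = (\<lambda>y. \<lambda>b\<in>K (n p) p. \<theta> y p (n p) b)"
    let ?F = "(\<lambda>x. x [^]\<^bsub>G\<^esub> m) ` carrier G"
    \<comment> \<open>an \<open>m\<close>-th power has all coordinates zero outside the finitely many summands of order \<open>p ^ n p\<close>\<close>
    have zero: "\<theta> (x [^]\<^bsub>G\<^esub> m) q i b = 0"
      if "x \<in> carrier G" "q \<in> M" "i \<in> {1..n q}" "b \<in> K i q" "(q, i) \<noteq> (p, n p)" for x q i b
    proof -
      have "q ^ i dvd m"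
      proof (cases "q = p")
        case True
        then have "i \<le> n p - 1" using that by auto
        then show ?thesis using True by (auto simp: m_def intro: dvd_mult2 le_imp_power_dvd)
      next
        case False
        then have "q ^ n q dvd r" unfolding r_def using that M(1) by (intro dvd_prodI) auto
        moreover have "q ^ i dvd q ^ n q" using that by (intro le_imp_power_dvd) auto
        ultimately show ?thesis unfolding m_def by (meson dvd_mult dvd_trans)
      qed
      then have "int (q ^ i) dvd int m * \<theta> x q i b"
        by (simp only: int_dvd_int_iff dvd_mult2)
      then show ?thesis using \<theta>pow[OF that(1-4)] by (simp only: dvd_imp_mod_0)
    qed
    have "inj_on \<psi> ?F"
    proof (rule inj_onI)
      fix y y' assume y: "y \<in> ?F" and y': "y' \<in> ?F" and eq: "\<psi> y = \<psi> y'"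
      have yG: "y \<in> carrier G" "y' \<in> carrier G" using y y' by auto
      have comp: "\<theta> y q i b = \<theta> y' q i b" if "q \<in> M" "i \<in> {1..n q}" "b \<in> K i q" for q i b
      proof (cases "(q, i) = (p, n p)")
        case True
        have "\<psi> y b = \<psi> y' b" using eq by simp
        then show ?thesis using True that by (simp add: \<psi>_def)
      next
        case False
        then show ?thesis using zero y y' that by auto
      qed
      have "\<theta> y = \<theta> y'"
      proof (rule extensionalityI[of _ M])
        show "\<theta> y \<in> extensional M" "\<theta> y' \<in> extensional M"
          using \<theta>S[OF yG(1)] \<theta>S[OF yG(2)] unfolding carS by blast+
        fix q assume q: "q \<in> M"
        show "\<theta> y q = \<theta> y' q"
        proof (rule extensionalityI[of _ "{1..n q}"])
          show "\<theta> y q \<in> extensional {1..n q}" "\<theta> y' q \<in> extensional {1..n q}"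
            using \<theta>S[OF yG(1)] \<theta>S[OF yG(2)] q unfolding carS by blast+
          fix i assume i: "i \<in> {1..n q}"
          show "\<theta> y q i = \<theta> y' q i"
          proof (rule extensionalityI[of _ "K i q"])
            show "\<theta> y q i \<in> extensional (K i q)" "\<theta> y' q i \<in> extensional (K i q)"
              using \<theta>S[OF yG(1)] \<theta>S[OF yG(2)] q i unfolding carS by blast+
          qed (use comp q i in blast)
        qed
      qed
      then show "y = y'" using \<theta> yG by (auto simp: iso_def bij_betw_def inj_on_eq_iff)
    qed
    moreover have "\<psi> ` ?F \<subseteq> K (n p) p \<rightarrow>\<^sub>E {0..<int (p ^ n p)}"
    proof
      fix z assume "z \<in> \<psi> ` ?F"
      then obtain y where y: "y \<in> carrier G" "z = \<psi> y" by auto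
      have "\<forall>b\<in>K (n p) p. \<theta> y p (n p) b \<in> {0..<int (p ^ n p)}"
        using \<theta>S[OF y(1)] p np(2) unfolding carS by blast
      then show "z \<in> K (n p) p \<rightarrow>\<^sub>E {0..<int (p ^ n p)}"
        unfolding y(2) \<psi>_def by (simp only: restrict_PiE_iff)
    qed
    then have "finite (\<psi> ` ?F)"
      by (rule finite_subset) (intro finite_PiE finK finite_atLeastLessThan_int)
    ultimately show ?thesis by (metis finite_imageD)
  qed
  have "\<xi> \<in> continuous_characters G T"
    unfolding continuous_characters_def
  proof (intro CollectI conjI homI)
    show "\<xi> x \<in> carrier circle_group" for x by (simp add: \<xi>_def circle_group_def)
    show "continuous_map T (top_of_set (carrier circle_group)) \<xi>"
      using continuous_map_factor_power[OF grpG T haus fin fac]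
      by (auto simp: continuous_map_in_subtopology \<xi>_def circle_group_def)
    fix x y assume xy: "x \<in> carrier G" "y \<in> carrier G"
    define a b where "a = \<theta> x p (n p) j" and "b = \<theta> y p (n p) j"
    have "int (p ^ n p) dvd (a + b) mod int (p ^ n p) - (a + b)"
      by (metis dvd_minus_mod dvd_diff_commute)
    moreover have "int p dvd int (p ^ n p)"
      using np by (metis dvd_power less_eq_Suc_le One_nat_def of_nat_dvd_iff)
    ultimately have "int p dvd (a + b) mod int (p ^ n p) - (a + b)" by (rule dvd_trans[rotated])
    then have "\<xi> (x \<otimes>\<^bsub>G\<^esub> y) = cis (2 * pi * real_of_int (a + b) / real p)"
      unfolding \<xi>_def using \<theta>mult[OF xy p np(2) j] p1 cis_cong[of p _ "a + b"] by (simp add: a_def b_def)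
    also have "\<dots> = \<xi> x * \<xi> y"
      by (simp add: \<xi>_def a_def b_def cis_mult add_divide_distrib distrib_left)
    finally show "\<xi> (x \<otimes>\<^bsub>G\<^esub> y) = \<xi> x \<otimes>\<^bsub>circle_group\<^esub> \<xi> y"
      by (simp add: circle_group_def)
  qed
  moreover assume "minimally_almost_periodic G T"
  ultimately have triv: "\<xi> x = 1" if "x \<in> carrier G" for x
    using that by (auto simp: minimally_almost_periodic_def von_neumann_radical_def kernel_def circle_group_def)
  define e where "e = (\<lambda>q\<in>M. \<lambda>i\<in>{1..n q}. \<lambda>b\<in>K i q. if q = p \<and> i = n p \<and> b = j then 1 else (0::int))"
  have fin_e: "finite {b \<in> K i q. (if q = p \<and> i = n p \<and> b = j then 1 else (0::int)) \<noteq> 0}" for i q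
    by (rule finite_subset[of _ "{j}"]) auto
  have "e \<in> carrier S"
    unfolding carS using fin_e pos p1 np by (auto simp: e_def cong: conj_cong)
  then have "e \<in> \<theta> ` carrier G"
    using \<theta> by (simp add: iso_def bij_betw_def)
  then obtain x where x: "x \<in> carrier G" "\<theta> x = e" by blast
  have "\<theta> x p (n p) j = 1" using x p np j by (simp add: e_def)
  then have "\<xi> x \<noteq> 1" using cis_primitive_root_neq_1[OF p1] by (simp add: \<xi>_def)
  then show False using triv x by blast
qed

section \<open>Group norms and characters\<close>

text \<open>The topology is that of the invariant metric \<open>\<nu> (x \<otimes> inv y)\<close>. Outside the carrier the distance is
  set to \<open>0\<close> only because \<^locale>\<open>Metric_space\<close> asks for symmetry of a total function.\<close>

lemma (in comm_group) norm_group_topology: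
  fixes \<nu> :: "'a \<Rightarrow> real"
  assumes nonneg: "\<And>x. x \<in> carrier G \<Longrightarrow> 0 \<le> \<nu> x"
    and zero: "\<And>x. x \<in> carrier G \<Longrightarrow> \<nu> x = 0 \<longleftrightarrow> x = \<one>"
    and sub: "\<And>x y. \<lbrakk>x \<in> carrier G; y \<in> carrier G\<rbrakk> \<Longrightarrow> \<nu> (x \<otimes> y) \<le> \<nu> x + \<nu> y"
    and sym: "\<And>x. x \<in> carrier G \<Longrightarrow> \<nu> (inv x) = \<nu> x"
  obtains T where "group_topology G T" "Hausdorff_space T"
    "\<And>U. \<lbrakk>openin T U; \<one> \<in> U\<rbrakk> \<Longrightarrow> \<exists>\<epsilon>>0. \<forall>x\<in>carrier G. \<nu> x < \<epsilon> \<longrightarrow> x \<in> U"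
proof -
  define d where "d = (\<lambda>x y. if x \<in> carrier G \<and> y \<in> carrier G then \<nu> (x \<otimes> inv y) else 0)"
  have d: "d x y = \<nu> (x \<otimes> inv y)" if "x \<in> carrier G" "y \<in> carrier G" for x y
    using that by (simp add: d_def)
  have comm: "\<nu> (y \<otimes> inv x) = \<nu> (x \<otimes> inv y)" if "x \<in> carrier G" "y \<in> carrier G" for x y
    using sym[of "x \<otimes> inv y"] that by (simp add: inv_mult m_comm)
  interpret Metric_space "carrier G" d
  proof
    show "0 \<le> d x y" for x y by (simp add: d_def nonneg)
    show "d x y = d y x" for x y by (simp add: d_def comm)
    show "d x y = 0 \<longleftrightarrow> x = y" if "x \<in> carrier G" "y \<in> carrier G" for x y
      using that by (simp add: d zero) (metis inv_closed inv_equality inv_inv r_inv)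
    show "d x z \<le> d x y + d y z" if "x \<in> carrier G" "y \<in> carrier G" "z \<in> carrier G" for x y z
    proof -
      have "x \<otimes> inv z = (x \<otimes> inv y) \<otimes> (y \<otimes> inv z)"
        using that by (metis inv_closed inv_solve_right m_assoc m_closed)
      then show ?thesis using sub[of "x \<otimes> inv y" "y \<otimes> inv z"] that by (simp add: d)
    qed
  qed
  have mult: "continuous_map (prod_topology mtopology mtopology) mtopology (\<lambda>(x, y). x \<otimes> y)"
    unfolding continuous_map_def
  proof (intro conjI allI impI)
    fix U assume U: "openin mtopology U"
    let ?P = "{z \<in> topspace (prod_topology mtopology mtopology). (case z of (x, y) \<Rightarrow> x \<otimes> y) \<in> U}"
    show "openin (prod_topology mtopology mtopology) ?P"
      unfolding openin_prod_topology_alt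
    proof (intro allI impI)
      fix x y assume "(x, y) \<in> ?P"
      then have xy: "x \<in> carrier G" "y \<in> carrier G" "x \<otimes> y \<in> U" by auto
      then obtain r where r: "r > 0" "mball (x \<otimes> y) r \<subseteq> U" using U openin_mtopology by blast
      have "mball x (r/2) \<times> mball y (r/2) \<subseteq> ?P"
      proof clarsimp
        fix x' y' assume x': "x' \<in> carrier G" "d x x' * 2 < r" and y': "y' \<in> carrier G" "d y y' * 2 < r"
        have "(x \<otimes> y) \<otimes> inv (x' \<otimes> y') = (x \<otimes> inv x') \<otimes> (y \<otimes> inv y')"
          using xy x' y' by (simp add: inv_mult m_ac)
        then have "d (x \<otimes> y) (x' \<otimes> y') \<le> d x x' + d y y'"
          using sub[of "x \<otimes> inv x'" "y \<otimes> inv y'"] xy x' y' by (simp add: d)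
        then have "x' \<otimes> y' \<in> mball (x \<otimes> y) r" using xy x' y' by simp
        then show "x' \<otimes> y' \<in> U" using r by blast
      qed
      then show "\<exists>V W. openin mtopology V \<and> openin mtopology W \<and> x \<in> V \<and> y \<in> W \<and> V \<times> W \<subseteq> ?P"
        using xy r by (intro exI[of _ "mball x (r/2)"] exI[of _ "mball y (r/2)"]) auto
    qed
  qed auto
  have inv: "continuous_map mtopology mtopology (\<lambda>x. inv x)"
    unfolding continuous_map_def
  proof (intro conjI allI impI)
    fix U assume U: "openin mtopology U"
    show "openin mtopology {x \<in> topspace mtopology. inv x \<in> U}"
      unfolding openin_mtopology
    proof (intro conjI allI impI)
      fix x assume "x \<in> {x \<in> topspace mtopology. inv x \<in> U}"
      then have x: "x \<in> carrier G" "inv x \<in> U" by auto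
      then obtain r where r: "r > 0" "mball (inv x) r \<subseteq> U" using U openin_mtopology by blast
      have "d (inv x) (inv y) = d x y" if "y \<in> carrier G" for y
        using that x comm[of x y] by (simp add: d m_comm)
      then have "mball x r \<subseteq> {x \<in> topspace mtopology. inv x \<in> U}"
        using r x by auto
      then show "\<exists>r>0. mball x r \<subseteq> {x \<in> topspace mtopology. inv x \<in> U}" using r by blast
    qed auto
  qed auto
  show thesis
  proof (rule that[of mtopology])
    show "group_topology G mtopology" using mult inv by (simp add: group_topology_def)
    show "Hausdorff_space mtopology" by (rule Hausdorff_space_mtopology)
    fix U assume "openin mtopology U" "\<one> \<in> U"
    then obtain r where r: "r > 0" "mball \<one> r \<subseteq> U" using openin_mtopology by blast
    have "x \<in> U" if "x \<in> carrier G" "\<nu> x < r" for x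
      using that r by (auto simp: subset_iff d sym)
    then show "\<exists>\<epsilon>>0. \<forall>x\<in>carrier G. \<nu> x < \<epsilon> \<longrightarrow> x \<in> U" using r by blast
  qed
qed

lemma group_circle_group: "group circle_group"
proof (rule groupI)
  fix z assume "z \<in> carrier circle_group"
  then have z: "norm z = 1" by (simp add: circle_group_def)
  then have "z \<noteq> 0" by auto
  with z show "\<exists>w\<in>carrier circle_group. w \<otimes>\<^bsub>circle_group\<^esub> z = \<one>\<^bsub>circle_group\<^esub>"
    by (intro bexI[of _ "inverse z"]) (auto simp: circle_group_def norm_inverse)
qed (auto simp: circle_group_def norm_mult)

text \<open>The circle has no small subgroups; for roots of unity this follows from
  \<open>1 + z + \<dots> + z ^ (k - 1) = 0\<close>.\<close>

lemma root_of_unity_in_right_half_plane: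
  fixes z :: complex
  assumes "z ^ k = 1" "k > 0" and "\<And>m. 0 < Re (z ^ m)"
  shows "z = 1"
proof (rule ccontr)
  assume "z \<noteq> 1"
  then have "(\<Sum>m<k. z ^ m) = 0"
    using geometric_sum[of z k] assms(1) by simp
  then have "(\<Sum>m<k. Re (z ^ m)) = 0" by (metis Re_sum zero_complex.sel(1))
  moreover have "(\<Sum>m<k. Re (z ^ m)) > 0" using assms by (intro sum_pos) auto
  ultimately show False by simp
qed

section \<open>Groups of step functions\<close>

text \<open>The basis \<open>B\<close> is split into blocks by \<open>lab\<close>. A basis element \<open>b\<close> of block \<open>l\<close> stands for the
  step function on \<open>[0,1)\<close> that is \<open>N l / ord b\<close> modulo \<open>N l\<close> on \<open>[0, q b)\<close>
  and \<open>0\<close> elsewhere, and so an element of the group stands for a family of step functions, one for each block. The elements of full order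
  \<open>N l\<close> have to be dense in the block, since they are used to approximate the others; the remaining elements may have
  any order dividing \<open>N l\<close>, which lets a block absorb finitely many summands of smaller order.\<close>

locale block_basis = comm_group G for G :: "('a, 'b) monoid_scheme" (structure) +
  fixes B :: "'a set" and lab :: "'a \<Rightarrow> 'c" and q :: "'a \<Rightarrow> real" and N :: "'c \<Rightarrow> nat"
  assumes indep: "independent B"
    and gen: "carrier G \<subseteq> combinations B"
    and B_ne: "B \<noteq> {}"
    and N_pos: "b \<in> B \<Longrightarrow> 0 < N (lab b)"
    and ord_dvd_N: "b \<in> B \<Longrightarrow> ord b dvd N (lab b)"
    and q_pos: "b \<in> B \<Longrightarrow> 0 < q b"
    and q_less_1: "b \<in> B \<Longrightarrow> q b < 1"
    and q_inj: "\<lbrakk>b \<in> B; b' \<in> B; lab b = lab b'; q b = q b'\<rbrakk> \<Longrightarrow> b = b'"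
    and dense: "\<lbrakk>b \<in> B; 0 \<le> u; u < v; v \<le> 1\<rbrakk>
      \<Longrightarrow> \<exists>b'\<in>B. lab b' = lab b \<and> ord b' = N (lab b) \<and> u < q b' \<and> q b' < v"
begin

lemma B_carrier: "B \<subseteq> carrier G"
  using indep by (simp add: independent_def)

lemma coordsG:
  assumes "x \<in> carrier G"
  shows "Poly_Mapping.keys (coords B x) \<subseteq> B" "frag_eval (coords B x) = x"
  using coords gen assms by blast+

definition weight :: "'c \<Rightarrow> real \<Rightarrow> 'a \<Rightarrow> int" where
  "weight l t b = (if lab b = l \<and> t < q b then int (N l div ord b) else 0)"

text \<open>The value at \<open>t\<close> of the step function of a combination, before reduction modulo \<open>N l\<close>.\<close>

definition step :: "('a \<Rightarrow>\<^sub>0 int) \<Rightarrow> 'c \<Rightarrow> real \<Rightarrow> int" where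
  "step c l t = (\<Sum>b\<in>Poly_Mapping.keys c. Poly_Mapping.lookup c b * weight l t b)"

lemma step_superset:
  assumes "finite F" "Poly_Mapping.keys c \<subseteq> F"
  shows "step c l t = (\<Sum>b\<in>F. Poly_Mapping.lookup c b * weight l t b)"
  unfolding step_def using assms by (intro sum.mono_neutral_left) (auto simp: in_keys_iff)

lemma step_add: "step (c + d) l t = step c l t + step d l t"
proof -
  let ?F = "Poly_Mapping.keys c \<union> Poly_Mapping.keys d"
  have "step (c + d) l t = (\<Sum>b\<in>?F. Poly_Mapping.lookup (c + d) b * weight l t b)"
    by (intro step_superset) (auto dest: subsetD[OF keys_add])
  also have "\<dots> = (\<Sum>b\<in>?F. Poly_Mapping.lookup c b * weight l t b) + (\<Sum>b\<in>?F. Poly_Mapping.lookup d b * weight l t b)"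
    by (simp add: lookup_add distrib_right sum.distrib)
  also have "\<dots> = step c l t + step d l t"
    by (simp add: step_superset[of ?F])
  finally show ?thesis .
qed

lemma step_cmul: "step (frag_cmul k c) l t = k * step c l t"
proof -
  have "step (frag_cmul k c) l t = (\<Sum>b\<in>Poly_Mapping.keys c. k * Poly_Mapping.lookup c b * weight l t b)"
    by (subst step_superset[of "Poly_Mapping.keys c"]) (auto simp: keys_cmul)
  then show ?thesis by (simp add: step_def sum_distrib_left mult.assoc)
qed

lemma step_minus: "step (- c) l t = - step c l t"
  using step_cmul[of "-1" c] by simp

lemma step_diff: "step (c - d) l t = step c l t - step d l t"
  using step_add[of c "- d"] by (simp add: step_minus)

lemma step_of: "step (frag_of b) l t = weight l t b"
  by (simp add: step_def)

lemma weight_dvd: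
  assumes "b \<in> B" "int (ord b) dvd k"
  shows "int (N l) dvd k * weight l t b"
proof (cases "lab b = l \<and> t < q b")
  case True
  then have "N l = ord b * (N l div ord b)" using ord_dvd_N[OF assms(1)] by auto
  then have "int (N l) = int (ord b) * int (N l div ord b)" by (metis of_nat_mult)
  then show ?thesis using True assms(2) by (simp add: weight_def mult_dvd_mono)
qed (auto simp: weight_def)

text \<open>Combinations with the same value differ by terms \<open>b [^] k\<close> that are trivial, and the step functions of
  these vanish modulo \<open>N l\<close>.\<close>

lemma step_cong:
  assumes c: "Poly_Mapping.keys c \<subseteq> B" and d: "Poly_Mapping.keys d \<subseteq> B"
    and eq: "frag_eval c = frag_eval d"
  shows "int (N l) dvd step c l t \<longleftrightarrow> int (N l) dvd step d l t"
proof -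
  have "int (N l) dvd step (c - d) l t"
    unfolding step_def
  proof (rule dvd_sum)
    fix b assume "b \<in> Poly_Mapping.keys (c - d)"
    then have b: "b \<in> B" using keys_diff[of c d] c d by blast
    then have "int (ord b) dvd Poly_Mapping.lookup (c - d) b"
      using frag_eval_eq_iff[OF indep c d] eq by (simp add: lookup_minus)
    then show "int (N l) dvd Poly_Mapping.lookup (c - d) b * weight l t b"
      by (rule weight_dvd[OF b])
  qed
  then show ?thesis by (metis step_diff dvd_diff_commute dvd_diff_right_iff)
qed

definition step_support :: "'a \<Rightarrow> 'c \<Rightarrow> real set" where
  "step_support x l = {t \<in> {0..<1}. \<not> int (N l) dvd step (coords B x) l t}"

lemma step_support_eval:
  assumes "Poly_Mapping.keys c \<subseteq> B"
  shows "step_support (frag_eval c) l = {t \<in> {0..<1}. \<not> int (N l) dvd step c l t}"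
proof -
  have "frag_eval c \<in> carrier G" using assms B_carrier by auto
  from step_cong[OF coordsG(1)[OF this] assms coordsG(2)[OF this]]
  show ?thesis by (simp add: step_support_def)
qed

lemma step_support_measurable: "step_support x l \<in> sets borel"
proof (cases "N l = 0")
  case False
  let ?c = "coords B x"
  have "(\<lambda>t. real_of_int (step ?c l t) / real (N l)) \<in> borel_measurable borel"
  proof -
    have "(\<lambda>t. real_of_int (weight l t b)) =
      (\<lambda>t. (if lab b = l then real (N l div ord b) else 0) * indicator {..<q b} t)" for b
      by (auto simp: weight_def fun_eq_iff)
    then have "(\<lambda>t. real_of_int (weight l t b)) \<in> borel_measurable borel" for b
      by simp
    then show ?thesis unfolding step_def by simp
  qed
  then have "(\<lambda>t. real_of_int (step ?c l t) / real (N l)) -` \<int> \<inter> space borel \<in> sets borel"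
    by (rule measurable_sets) (simp add: closed_Ints)
  moreover have "real_of_int k / real (N l) \<in> \<int> \<longleftrightarrow> int (N l) dvd k" for k
  proof
    assume "real_of_int k / real (N l) \<in> \<int>"
    then obtain j where "real_of_int k / real (N l) = of_int j" by (elim Ints_cases)
    then have "real_of_int k = real_of_int (j * int (N l))" using False by (simp add: field_simps)
    then show "int (N l) dvd k" using of_int_eq_iff by (metis dvd_triv_right)
  qed (use False in auto)
  ultimately have "{t. int (N l) dvd step ?c l t} \<in> sets borel"
    by (simp add: vimage_def)
  moreover have "step_support x l = {0..<1} - {t. int (N l) dvd step ?c l t}"
    by (auto simp: step_support_def)
  ultimately show ?thesis by simp
next
  case True
  have "weight l t b = 0" for t b by (simp add: weight_def True)
  then have "step_support x l = {}" by (simp add: step_support_def step_def)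
  then show ?thesis by simp
qed

lemma step_support_fmeasurable: "step_support x l \<in> fmeasurable lborel"
proof (rule fmeasurableI2[of "{0..1}"])
  show "{0..1::real} \<in> fmeasurable lborel" by (intro fmeasurableI) auto
  show "step_support x l \<subseteq> {0..1}" by (auto simp: step_support_def)
qed (simp add: step_support_measurable)

lemma measure_step_support_le_Ico:
  assumes "step_support x l \<subseteq> {u..<v}" "u \<le> v"
  shows "measure lborel (step_support x l) \<le> v - u"
proof -
  have "measure lborel (step_support x l) \<le> measure lborel {u..<v}"
    using assms by (intro measure_mono_fmeasurable fmeasurableI) (auto simp: step_support_measurable)
  then show ?thesis using assms by simp
qed

lemma measure_step_support_le_1: "measure lborel (step_support x l) \<le> 1"
proof -
  have "step_support x l \<subseteq> {0..<1}" by (auto simp: step_support_def)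
  then show ?thesis using measure_step_support_le_Ico[of x l 0 1] by simp
qed

text \<open>The norm that induces convergence in measure, uniformly over the blocks. It is bounded by \<open>1\<close>, so
  the supremum over infinitely many blocks exists.\<close>

definition support_norm :: "'a \<Rightarrow> real" where
  "support_norm x = (SUP l\<in>lab ` B. measure lborel (step_support x l))"

lemma support_norm_upper:
  assumes "b \<in> B"
  shows "measure lborel (step_support x (lab b)) \<le> support_norm x"
  unfolding support_norm_def using assms measure_step_support_le_1
  by (intro cSUP_upper) (auto intro!: bdd_aboveI2)

lemma support_norm_least:
  assumes "\<And>b. b \<in> B \<Longrightarrow> measure lborel (step_support x (lab b)) \<le> u"
  shows "support_norm x \<le> u"
  unfolding support_norm_def using assms B_ne by (intro cSUP_least) auto

lemma support_norm_nonneg: "0 \<le> support_norm x"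
proof -
  obtain b where "b \<in> B" using B_ne by blast
  from support_norm_upper[OF this, of x] show ?thesis
    using measure_nonneg[of lborel "step_support x (lab b)"] by linarith
qed

lemma support_norm_mult:
  assumes "x \<in> carrier G" "y \<in> carrier G"
  shows "support_norm (x \<otimes> y) \<le> support_norm x + support_norm y"
proof (rule support_norm_least)
  fix b assume b: "b \<in> B"
  let ?l = "lab b"
  have k: "Poly_Mapping.keys (coords B x + coords B y) \<subseteq> B"
    using coordsG(1)[OF assms(1)] coordsG(1)[OF assms(2)] keys_add[of "coords B x" "coords B y"] by blast
  have "x \<otimes> y = frag_eval (coords B x + coords B y)"
    using coordsG[OF assms(1)] coordsG[OF assms(2)] B_carrier by (simp add: frag_eval_add subset_trans)
  then have "step_support (x \<otimes> y) ?l \<subseteq> step_support x ?l \<union> step_support y ?l"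
    using step_support_eval[OF k] by (auto simp: step_add step_support_def)
  then have "measure lborel (step_support (x \<otimes> y) ?l) \<le> measure lborel (step_support x ?l \<union> step_support y ?l)"
    by (intro measure_mono_fmeasurable fmeasurable.Un step_support_fmeasurable)
      (simp_all add: step_support_measurable)
  also have "\<dots> \<le> measure lborel (step_support x ?l) + measure lborel (step_support y ?l)"
    by (intro measure_Un_le) (simp_all add: step_support_measurable)
  also have "\<dots> \<le> support_norm x + support_norm y"
    by (intro add_mono support_norm_upper b)
  finally show "measure lborel (step_support (x \<otimes> y) ?l) \<le> support_norm x + support_norm y" .
qed

lemma support_norm_inv:
  assumes "x \<in> carrier G"
  shows "support_norm (inv x) = support_norm x"
proof -
  have k: "Poly_Mapping.keys (frag_cmul (-1) (coords B x)) \<subseteq> B"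
    using coordsG(1)[OF assms] keys_cmul by blast
  have "inv x = frag_eval (frag_cmul (-1) (coords B x))"
    using coordsG[OF assms] B_carrier by (simp add: frag_eval_minus subset_trans)
  then have "step_support (inv x) l = step_support x l" for l
    using step_support_eval[OF k] by (simp add: step_minus step_support_def)
  then show ?thesis by (simp add: support_norm_def)
qed

text \<open>Among the basis elements of a block that contribute nontrivially to an element, let \<open>b1\<close> be the one with the
  largest \<open>q b1\<close>. Just to the left of \<open>q b1\<close> the step function is the term of \<open>b1\<close> alone, modulo \<open>N l\<close>. So its
  support contains an interval.\<close>

lemma support_norm_eq_0_iff:
  assumes x: "x \<in> carrier G"
  shows "support_norm x = 0 \<longleftrightarrow> x = \<one>"
proof
  assume "x = \<one>"
  then have "step_support x l = {}" for l
    using step_support_eval[of 0] by (simp add: step_def)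
  then have "support_norm x \<le> 0" by (intro support_norm_least) simp
  then show "support_norm x = 0" using support_norm_nonneg[of x] by linarith
next
  assume nz: "support_norm x = 0"
  show "x = \<one>"
  proof (rule ccontr)
    assume "x \<noteq> \<one>"
    define c where "c = coords B x"
    have c: "Poly_Mapping.keys c \<subseteq> B" "frag_eval c = x" using coordsG[OF x] by (auto simp: c_def)
    then obtain b0 where b0: "b0 \<in> B" "\<not> int (ord b0) dvd Poly_Mapping.lookup c b0"
      using frag_eval_eq_iff[OF indep c(1), of 0] \<open>x \<noteq> \<one>\<close> by auto
    define l where "l = lab b0"
    define Q where "Q = {b \<in> Poly_Mapping.keys c. lab b = l \<and> \<not> int (ord b) dvd Poly_Mapping.lookup c b}"
    have Q: "finite Q" "b0 \<in> Q" "Q \<subseteq> B" using b0 c(1) by (auto simp: Q_def l_def in_keys_iff)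
    obtain b1 where b1: "b1 \<in> Q" "\<And>b. b \<in> Q \<Longrightarrow> q b \<le> q b1"
    proof -
      have "Max (q ` Q) \<in> q ` Q" using Q by (intro Max_in) auto
      then obtain b1 where "b1 \<in> Q" "q b1 = Max (q ` Q)" by auto
      then show thesis using that[of b1] Q(1) by auto
    qed
    \<comment> \<open>the largest position below \<open>q b1\<close> of a nontrivial term, or \<open>0\<close> if \<open>b1\<close> is the only one\<close>
    define u where "u = Max (insert 0 (q ` (Q - {b1})))"
    have u: "0 \<le> u" "\<And>b. b \<in> Q - {b1} \<Longrightarrow> q b \<le> u"
      using Q(1) by (auto simp: u_def)
    have "q b < q b1" if "b \<in> Q - {b1}" for b
      using b1 that q_inj[of b b1] Q(3) by (force simp: Q_def)
    then have u1: "u < q b1" using Q(1,3) b1(1) q_pos by (auto simp: u_def)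
    have "\<not> int (N l) dvd step c l t" if t: "u \<le> t" "t < q b1" for t
    proof
      assume dvd: "int (N l) dvd step c l t"
      have b1k: "b1 \<in> Poly_Mapping.keys c" "b1 \<in> B" using b1(1) Q(3) by (auto simp: Q_def)
      have "step c l t = Poly_Mapping.lookup c b1 * weight l t b1 +
        (\<Sum>b\<in>Poly_Mapping.keys c - {b1}. Poly_Mapping.lookup c b * weight l t b)"
        unfolding step_def using b1k by (simp add: sum.remove)
      moreover have "int (N l) dvd (\<Sum>b\<in>Poly_Mapping.keys c - {b1}. Poly_Mapping.lookup c b * weight l t b)"
      proof (rule dvd_sum)
        fix b assume b: "b \<in> Poly_Mapping.keys c - {b1}"
        show "int (N l) dvd Poly_Mapping.lookup c b * weight l t b"
        proof (cases "b \<in> Q")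
          case True
          then have "q b \<le> t" using u(2)[of b] b t by auto
          then show ?thesis by (simp add: weight_def)
        next
          case False
          then show ?thesis
            using b c(1) weight_dvd[of b "Poly_Mapping.lookup c b" l t] by (cases "lab b = l") (auto simp: Q_def weight_def)
        qed
      qed
      ultimately have "int (N l) dvd Poly_Mapping.lookup c b1 * weight l t b1"
        using dvd by (simp add: dvd_add_left_iff)
      moreover have "weight l t b1 = int (N l div ord b1)"
        using b1(1) t by (simp add: weight_def Q_def)
      moreover have l1: "lab b1 = l" using b1(1) by (simp add: Q_def)
      moreover have "int (N l) = int (ord b1) * int (N l div ord b1)"
        using ord_dvd_N[OF b1k(2)] l1 by (metis dvd_mult_div_cancel of_nat_mult)
      moreover have "N l div ord b1 \<noteq> 0"
        using N_pos[OF b1k(2)] ord_dvd_N[OF b1k(2)] l1 by (metis dvd_div_eq_0_iff less_numeral_extra(3))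
      ultimately have "int (ord b1) dvd Poly_Mapping.lookup c b1"
        by (metis dvd_times_right_cancel_iff of_nat_eq_0_iff)
      then show False using b1(1) by (simp add: Q_def)
    qed
    then have "{u..<q b1} \<subseteq> step_support x l"
      using step_support_eval[OF c(1), of l] c(2) u(1) q_less_1[of b1] b1(1) Q(3) by auto
    then have "measure lborel {u..<q b1} \<le> measure lborel (step_support x l)"
      by (intro measure_mono_fmeasurable step_support_fmeasurable) auto
    also have "\<dots> \<le> support_norm x" using support_norm_upper[OF b0(1)] by (simp add: l_def)
    finally show False using u1 nz by simp
  qed
qed

lemma support_norm_power_basis:
  assumes b: "b \<in> B"
  shows "support_norm (b [^] (m::nat)) \<le> q b"
proof (rule support_norm_least)
  fix b' assume "b' \<in> B"
  have k: "Poly_Mapping.keys (frag_cmul (int m) (frag_of b)) \<subseteq> B" using b keys_cmul by fastforce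
  have "b [^] m = frag_eval (frag_cmul (int m) (frag_of b))"
    using b B_carrier by (subst frag_eval_cmul) (auto simp: int_pow_int)
  then have "step_support (b [^] m) (lab b') \<subseteq> {0..<q b}"
    using step_support_eval[OF k] by (auto simp: step_cmul step_of weight_def split: if_splits)
  then show "measure lborel (step_support (b [^] m) (lab b')) \<le> q b"
    using measure_step_support_le_Ico[of _ _ 0 "q b"] q_pos[OF b] by simp
qed

text \<open>The scaling factor makes the two step functions agree on \<open>[0, q a)\<close>. So all powers of the difference
  live on the short interval \<open>[q a, q b)\<close>: the difference generates a small subgroup.\<close>

lemma support_norm_power_difference:
  assumes b: "b \<in> B" and a: "a \<in> B" "lab a = lab b" "ord a = N (lab b)" "q a \<le> q b"
  shows "support_norm ((b \<otimes> inv (a [^] (N (lab b) div ord b))) [^] (m::nat)) \<le> q b - q a"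
proof (rule support_norm_least)
  fix b' assume "b' \<in> B"
  define w where "w = N (lab b) div ord b"
  define c where "c = frag_of b - frag_cmul (int w) (frag_of a)"
  have c: "Poly_Mapping.keys c \<subseteq> B"
    using a b keys_diff[of "frag_of b" "frag_cmul (int w) (frag_of a)"] keys_cmul[of "int w" "frag_of a"]
    by (auto simp: c_def)
  have k: "Poly_Mapping.keys (frag_cmul (int m) c) \<subseteq> B" using c keys_cmul by blast
  have ab: "a \<in> carrier G" "b \<in> carrier G" using a b B_carrier by auto
  have "frag_eval c = b \<otimes> inv (a [^] w)"
    unfolding c_def using ab keys_cmul[of "int w" "frag_of a"]
    by (subst frag_eval_diff) (auto simp: frag_eval_cmul int_pow_int)
  then have pw: "(b \<otimes> inv (a [^] w)) [^] m = frag_eval (frag_cmul (int m) c)"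
    using c B_carrier by (simp add: frag_eval_cmul int_pow_int subset_trans)
  have "step c l t = 0" if "t < q a \<or> q b \<le> t" for l t
    using that a N_pos[OF b] by (auto simp: c_def step_diff step_cmul step_of weight_def w_def)
  then have "int (N l) dvd int m * step c l t" if "t \<notin> {q a..<q b}" for l t
    using that by (simp add: not_le not_less)
  then have "step_support ((b \<otimes> inv (a [^] w)) [^] m) (lab b') \<subseteq> {q a..<q b}"
    unfolding pw step_support_eval[OF k] step_cmul by blast
  then show "measure lborel (step_support ((b \<otimes> inv (a [^] (N (lab b) div ord b))) [^] m) (lab b')) \<le> q b - q a"
    using measure_step_support_le_Ico[of _ _ "q a" "q b"] a(4) by (simp add: w_def)
qed

lemma basis_torsion: "b \<in> B \<Longrightarrow> b [^] N (lab b) = \<one>"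
  using ord_dvd_N B_carrier by (auto simp: pow_eq_id)

text \<open>A character that maps a neighbourhood of the identity into the right half-plane is trivial on
  all small cyclic subgroups. A basis element \<open>b\<close> with small \<open>q b\<close> generates one, and every other basis element
  can be reached from these by steps of length less than \<open>\<epsilon>\<close> along elements of full order.\<close>

lemma character_trivial:
  assumes hom: "\<xi> \<in> hom G circle_group" and \<epsilon>: "\<epsilon> > 0"
    and small: "\<And>x. \<lbrakk>x \<in> carrier G; support_norm x < \<epsilon>\<rbrakk> \<Longrightarrow> 0 < Re (\<xi> x)"
    and x: "x \<in> carrier G"
  shows "\<xi> x = 1"
proof -
  have grp: "group G" by unfold_locales
  interpret \<xi>: group_hom G circle_group \<xi>
    using hom by (intro group_hom.intro group_hom_axioms.intro grp group_circle_group)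
  have pow: "\<xi> (y [^] m) = \<xi> y ^ m" if "y \<in> carrier G" for y and m :: nat
  proof -
    have "z [^]\<^bsub>circle_group\<^esub> m = z ^ m" for z
      by (induction m) (simp_all add: circle_group_def nat_pow_def)
    then show ?thesis using \<xi>.hom_nat_pow[OF that] by simp
  qed
  have one: "\<xi> \<one> = 1" using \<xi>.hom_one by (simp add: circle_group_def)
  have mult: "\<xi> (y \<otimes> z) = \<xi> y * \<xi> z" if "y \<in> carrier G" "z \<in> carrier G" for y z
    using \<xi>.hom_mult[OF that] by (simp add: circle_group_def)
  have small_trivial: "\<xi> y = 1"
    if y: "y \<in> carrier G" "y [^] k = \<one>" "0 < k" and s: "\<And>m::nat. support_norm (y [^] m) < \<epsilon>" for y and k :: nat
  proof (rule root_of_unity_in_right_half_plane)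
    show "\<xi> y ^ k = 1" using pow[OF y(1), of k] y(2) one by simp
    show "0 < Re (\<xi> y ^ m)" for m using small[OF _ s] y(1) pow by simp
  qed (use y in simp)
  \<comment> \<open>thresholds grow by \<open>\<epsilon> / 2\<close>, so that an element below one threshold is
    within \<open>\<epsilon>\<close> of elements below the previous one\<close>
  have basis: "\<xi> b = 1" if "b \<in> B" "q b < (real k + 1) * (\<epsilon> / 2)" for k b
    using that
  proof (induction k arbitrary: b)
    case 0
    have "support_norm (b [^] m) < \<epsilon>" for m :: nat
      using support_norm_power_basis[OF 0(1), of m] 0(2) \<epsilon> by simp
    then show ?case
      using small_trivial[of b "N (lab b)"] basis_torsion[OF 0(1)] N_pos[OF 0(1)] 0(1) B_carrier by blast
  next
    case (Suc k)
    let ?v = "(real k + 1) * (\<epsilon> / 2)"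
    show ?case
    proof (cases "q b < ?v")
      case True
      then show ?thesis using Suc by blast
    next
      case False
      define v where "v = ?v"
      have "0 < v" using \<epsilon> by (simp add: v_def)
      moreover have v: "q b - \<epsilon> < v" "v \<le> q b"
        using Suc.prems(2) \<epsilon> False by (auto simp: v_def algebra_simps)
      ultimately have "max 0 (q b - \<epsilon>) < v" "v \<le> 1" using q_less_1[OF Suc.prems(1)] by auto
      then obtain a where a: "a \<in> B" "lab a = lab b" "ord a = N (lab b)" "max 0 (q b - \<epsilon>) < q a" "q a < v"
        using dense[OF Suc.prems(1), of "max 0 (q b - \<epsilon>)" v] by auto
      define y where "y = b \<otimes> inv (a [^] (N (lab b) div ord b))"
      have ab: "a \<in> carrier G" "b \<in> carrier G" using a(1) Suc.prems(1) B_carrier by auto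
      have yG: "y \<in> carrier G" using ab by (simp add: y_def)
      have "support_norm (y [^] m) < \<epsilon>" for m :: nat
      proof -
        have "support_norm (y [^] m) \<le> q b - q a"
          unfolding y_def using v a by (intro support_norm_power_difference Suc.prems(1)) auto
        then show ?thesis using a(4) by simp
      qed
      moreover have "y [^] N (lab b) = \<one>"
      proof -
        have "y [^] N (lab b) = b [^] N (lab b) \<otimes> inv ((a [^] N (lab b)) [^] (N (lab b) div ord b))"
          using ab by (simp add: y_def pow_mult_distrib m_comm nat_pow_inv nat_pow_pow mult.commute)
        then show ?thesis using basis_torsion[OF Suc.prems(1)] basis_torsion[OF a(1)] a(2) by simp
      qed
      ultimately have "\<xi> y = 1"
        using small_trivial[OF yG] N_pos[OF Suc.prems(1)] by blast
      moreover have "\<xi> a = 1" using Suc.IH[OF a(1)] a(5) v_def by blast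
      moreover have "b = y \<otimes> a [^] (N (lab b) div ord b)"
        using ab by (simp add: y_def m_assoc)
      then have "\<xi> b = \<xi> y * \<xi> a ^ (N (lab b) div ord b)"
        using mult pow ab yG by (metis nat_pow_closed)
      ultimately show ?thesis by simp
    qed
  qed
  have "B \<subseteq> kernel G circle_group \<xi>"
  proof
    fix b assume b: "b \<in> B"
    obtain k :: nat where "q b / (\<epsilon> / 2) < real k" using reals_Archimedean2 by blast
    then have "q b < (real k + 1) * (\<epsilon> / 2)" using \<epsilon> by (simp add: field_simps)
    then have "\<xi> b = 1" using basis b by blast
    then show "b \<in> kernel G circle_group \<xi>" using b B_carrier by (auto simp: kernel_def circle_group_def)
  qed
  then have "frag_eval (coords B x) \<in> kernel G circle_group \<xi>"
    using coordsG(1)[OF x] by (intro frag_eval_in_subgroup \<xi>.subgroup_kernel) auto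
  then show ?thesis using coordsG(2)[OF x] by (simp add: kernel_def circle_group_def)
qed

theorem minimally_almost_periodic_topology:
  "\<exists>T. group_topology G T \<and> Hausdorff_space T \<and> minimally_almost_periodic G T"
proof -
  obtain T where T: "group_topology G T" "Hausdorff_space T"
    and nbhd: "\<And>U. \<lbrakk>openin T U; \<one> \<in> U\<rbrakk> \<Longrightarrow> \<exists>\<epsilon>>0. \<forall>x\<in>carrier G. support_norm x < \<epsilon> \<longrightarrow> x \<in> U"
    using norm_group_topology[of support_norm] support_norm_nonneg support_norm_eq_0_iff
      support_norm_mult support_norm_inv by blast
  have top: "topspace T = carrier G" using T by (simp add: group_topology_def)
  have "\<xi> x = 1" if \<xi>: "\<xi> \<in> continuous_characters G T" and x: "x \<in> carrier G" for \<xi> x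
  proof -
    have hom: "\<xi> \<in> hom G circle_group" and cont: "continuous_map T euclidean \<xi>"
      using \<xi> by (auto simp: continuous_characters_def continuous_map_in_subtopology)
    have "\<xi> \<one> = 1"
      using hom_one[OF hom _ group_circle_group] by (simp add: circle_group_def)
    have "openin T {x \<in> topspace T. \<xi> x \<in> {z. 0 < Re z}}"
      by (rule openin_continuous_map_preimage[OF cont]) (simp add: open_halfspace_Re_gt)
    then obtain \<epsilon> where "\<epsilon> > 0" "\<forall>x\<in>carrier G. support_norm x < \<epsilon> \<longrightarrow> 0 < Re (\<xi> x)"
      using nbhd[of "{x \<in> topspace T. \<xi> x \<in> {z. 0 < Re z}}"] \<open>\<xi> \<one> = 1\<close> top by auto
    then show ?thesis using character_trivial[OF hom _ _ x] by blast
  qed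
  then have "von_neumann_radical G T = carrier G"
  proof -
    assume *: "\<And>\<xi> x. \<xi> \<in> continuous_characters G T \<Longrightarrow> x \<in> carrier G \<Longrightarrow> \<xi> x = 1"
    have "(\<lambda>_. 1) \<in> continuous_characters G T"
      by (auto simp: continuous_characters_def hom_def circle_group_def)
    then show ?thesis
      using * by (fastforce simp: von_neumann_radical_def kernel_def circle_group_def)
  qed
  then show ?thesis using T by (auto simp: minimally_almost_periodic_def)
qed

end

section \<open>Sorting the basis into blocks\<close>

lemma infinite_rationals_between:
  fixes u v :: real
  assumes "u < v"
  shows "infinite {r \<in> \<rat>. u < r \<and> r < v}"
proof
  assume fin: "finite {r \<in> \<rat>. u < r \<and> r < v}"
  have "{r \<in> \<rat>. u < r \<and> r < v} \<noteq> {}" using Rats_dense_in_real[OF assms] by blast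
  with fin have m: "Min {r \<in> \<rat>. u < r \<and> r < v} \<in> {r \<in> \<rat>. u < r \<and> r < v}" by (rule Min_in)
  then obtain r where "r \<in> \<rat>" "u < r" "r < Min {r \<in> \<rat>. u < r \<and> r < v}"
    using Rats_dense_in_real by blast
  then show False using Min_le[OF fin, of r] m by auto
qed

lemma infinite_bij_times_nat:
  assumes "infinite C"
  shows "\<exists>g. bij_betw g C (C \<times> (UNIV :: nat set))"
proof -
  have "|C \<times> (UNIV :: nat set)| =o |C|"
    using card_of_Times_infinite[OF assms, of "UNIV :: nat set"] assms infinite_iff_card_of_nat by blast
  then show ?thesis using card_of_ordIso ordIso_symmetric by blast
qed

text \<open>Each class of \<open>N0\<close> is in bijection with its product with the rationals in \<open>(0, 1)\<close>; the first
  component labels the block, the second is the position \<open>q\<close>. Omitting the finitely many elements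
  with \<open>d b' \<noteq> N0 b\<close> from a class does not destroy density.\<close>

lemma exists_block_labelling:
  fixes B :: "'a set" and N0 d :: "'a \<Rightarrow> nat"
  assumes inf: "\<And>b. b \<in> B \<Longrightarrow> infinite {b' \<in> B. N0 b' = N0 b}"
    and fin: "\<And>b. b \<in> B \<Longrightarrow> finite {b' \<in> B. N0 b' = N0 b \<and> d b' \<noteq> N0 b}"
  obtains lab :: "'a \<Rightarrow> nat \<times> 'a" and q :: "'a \<Rightarrow> real"
  where "\<And>b. fst (lab b) = N0 b" "\<And>b. b \<in> B \<Longrightarrow> 0 < q b" "\<And>b. b \<in> B \<Longrightarrow> q b < 1"
    "\<And>b b'. \<lbrakk>b \<in> B; b' \<in> B; lab b = lab b'; q b = q b'\<rbrakk> \<Longrightarrow> b = b'"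
    "\<And>b u v. \<lbrakk>b \<in> B; 0 \<le> u; u < v; v \<le> 1\<rbrakk>
      \<Longrightarrow> \<exists>b'\<in>B. lab b' = lab b \<and> d b' = N0 b \<and> u < q b' \<and> q b' < v"
proof -
  define C where "C = (\<lambda>k. {b \<in> B. N0 b = k})"
  have "\<exists>g. infinite (C k) \<longrightarrow> bij_betw g (C k) (C k \<times> (UNIV :: nat set))" for k
    using infinite_bij_times_nat[of "C k"] by blast
  then obtain g where g: "\<And>k. infinite (C k) \<Longrightarrow> bij_betw (g k) (C k) (C k \<times> (UNIV :: nat set))"
    by metis
  define R where "R = {r \<in> \<rat>. 0 < r \<and> r < (1::real)}"
  have "infinite R" "countable R"
    using infinite_rationals_between[of 0 1] countable_rat by (auto simp: R_def intro: countable_subset)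
  then obtain e :: "nat \<Rightarrow> real" where e: "bij_betw e UNIV R"
    using bij_betw_from_nat_into by blast
  define lab where "lab = (\<lambda>b. (N0 b, fst (g (N0 b) b)))"
  define q where "q = (\<lambda>b. e (snd (g (N0 b) b)))"
  have qR: "q b \<in> R" for b using e by (auto simp: q_def bij_betw_def)
  have bC: "b \<in> C (N0 b)" if "b \<in> B" for b using that by (simp add: C_def)
  have infC: "infinite (C (N0 b))" if "b \<in> B" for b using inf[OF that] by (simp add: C_def)
  show thesis
  proof (rule that[of lab q])
    show "fst (lab b) = N0 b" for b by (simp add: lab_def)
    show "0 < q b" "q b < 1" for b using qR[of b] by (auto simp: R_def)
    fix b assume b: "b \<in> B"
    note gb = g[OF infC[OF b]]
    {
      fix b' assume b': "b' \<in> B" and lab: "lab b = lab b'" and q: "q b = q b'"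
      have N: "N0 b' = N0 b" using lab by (simp add: lab_def)
      have "snd (g (N0 b) b) = snd (g (N0 b) b')"
        using q e N by (simp add: q_def bij_betw_def inj_eq)
      moreover have "fst (g (N0 b) b) = fst (g (N0 b) b')" using lab N by (simp add: lab_def)
      ultimately have "g (N0 b) b = g (N0 b) b'" by (rule prod_eqI[rotated])
      then show "b = b'"
        using inj_onD[OF bij_betw_imp_inj_on[OF gb] _ bC[OF b]] bC[OF b'] N by simp
    }
    fix u v :: real assume uv: "0 \<le> u" "u < v" "v \<le> 1"
    define c where "c = fst (g (N0 b) b)"
    define f where "f = (\<lambda>k. inv_into (C (N0 b)) (g (N0 b)) (c, k))"
    have "g (N0 b) b \<in> C (N0 b) \<times> UNIV" using gb bC[OF b] by (auto simp: bij_betw_def)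
    then have cC: "c \<in> C (N0 b)" by (auto simp: c_def)
    have f: "f k \<in> C (N0 b)" "g (N0 b) (f k) = (c, k)" for k
    proof -
      have "(c, k) \<in> g (N0 b) ` C (N0 b)" using gb cC by (auto simp: bij_betw_def)
      then show "f k \<in> C (N0 b)" "g (N0 b) (f k) = (c, k)"
        unfolding f_def by (rule inv_into_into, rule f_inv_into_f)
    qed
    have f_inj: "inj f" by (rule injI) (metis f(2) prod.inject)
    define J where "J = {k. u < e k \<and> e k < v}"
    have "e ` J = {r \<in> \<rat>. u < r \<and> r < v}"
    proof
      show "e ` J \<subseteq> {r \<in> \<rat>. u < r \<and> r < v}" using e by (auto simp: J_def bij_betw_def R_def)
      show "{r \<in> \<rat>. u < r \<and> r < v} \<subseteq> e ` J"
      proof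
        fix r assume r: "r \<in> {r \<in> \<rat>. u < r \<and> r < v}"
        then have "r \<in> range e" using e uv by (auto simp: bij_betw_def R_def)
        then show "r \<in> e ` J" using r by (auto simp: J_def)
      qed
    qed
    then have "infinite J" using infinite_rationals_between[OF uv(2)] by (metis finite_imageI)
    then have "infinite (f ` J)" using f_inj by (meson finite_imageD inj_on_subset subset_UNIV)
    then have "\<not> f ` J \<subseteq> {b' \<in> B. N0 b' = N0 b \<and> d b' \<noteq> N0 b}"
      using fin[OF b] finite_subset by blast
    then obtain k where k: "k \<in> J" "f k \<notin> {b' \<in> B. N0 b' = N0 b \<and> d b' \<noteq> N0 b}" by blast
    have fk: "f k \<in> B" "N0 (f k) = N0 b" using f(1)[of k] by (auto simp: C_def)
    then have "d (f k) = N0 b" using k(2) by blast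
    moreover have "lab (f k) = lab b" using fk f(2)[of k] by (simp add: lab_def c_def)
    moreover have "q (f k) = e k" using fk f(2)[of k] by (simp add: q_def)
    ultimately show "\<exists>b'\<in>B. lab b' = lab b \<and> d b' = N0 b \<and> u < q b' \<and> q b' < v"
      using k(1) fk(1) by (intro bexI[of _ "f k"]) (auto simp: J_def)
  qed
qed

lemma (in comm_group) bounded_group_basis:
  assumes "bounded_group G"
  obtains B e where "independent B" "carrier G \<subseteq> combinations B"
    "\<And>b. b \<in> B \<Longrightarrow> \<exists>p k. Factorial_Ring.prime p \<and> 0 < k \<and> ord b = p ^ k"
    "0 < e" "\<And>x. x \<in> carrier G \<Longrightarrow> ord x \<le> e"
proof -
  define e where "e = group_exponent G"
  have "0 < e" using assms by (simp add: bounded_group_def e_def)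
  moreover have dvd: "ord x dvd e" if "x \<in> carrier G" for x
    unfolding e_def group_exponent_def using that by (intro dvd_Lcm) auto
  moreover have "x [^] e = \<one>" if "x \<in> carrier G" for x
    using dvd that by (simp add: pow_eq_id)
  ultimately obtain B where "independent B" "carrier G \<subseteq> combinations B"
    "\<forall>b\<in>B. \<exists>p k. Factorial_Ring.prime p \<and> 0 < k \<and> ord b = p ^ k"
    using bounded_subgroup_has_basis[OF _ subgroup_self] by blast
  then show thesis using that[of B e] \<open>0 < e\<close> dvd dvd_imp_le by blast
qed

text \<open>Basis elements are grouped by their order if infinitely many have that order. The remaining ones,
  finite in number, join the elements of largest order for the same prime, which are infinitely many by
  hypothesis.\<close>

lemma (in comm_group) minimally_almost_periodic_if_infinite_invariants:
  assumes infG: "infinite (carrier G)" and bdd: "bounded_group G"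
    and inv: "\<forall>\<kappa>\<in>leading_ulm_kaplansky_invariants G. cinfinite \<kappa>"
  shows "\<exists>T. group_topology G T \<and> Hausdorff_space T \<and> minimally_almost_periodic G T"
proof -
  obtain B e where B: "independent B" "carrier G \<subseteq> combinations B"
    and pp: "\<And>b. b \<in> B \<Longrightarrow> \<exists>p k. Factorial_Ring.prime p \<and> 0 < k \<and> ord b = p ^ k"
    and e: "0 < e" "\<And>x. x \<in> carrier G \<Longrightarrow> ord x \<le> e"
    using bounded_group_basis[OF bdd] by blast
  have BG: "B \<subseteq> carrier G" using B by (simp add: independent_def)
  have B_ne: "B \<noteq> {}"
  proof
    assume "B = {}"
    then have "carrier G \<subseteq> {\<one>}" using B(2) by (auto simp: combinations_def)
    then show False using infG finite_subset by blast
  qed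
  define M where "M = {p. Factorial_Ring.prime p \<and> (\<exists>b\<in>B. \<exists>k>0. ord b = p ^ k)}"
  define n where "n = (\<lambda>p. Max {k. \<exists>b\<in>B. ord b = p ^ k})"
  have bound: "k \<le> e \<and> p \<le> e" if "Factorial_Ring.prime p" "b \<in> B" "ord b = p ^ k" "k > 0" for p k b
  proof -
    have p: "p > 1" using that prime_gt_1_nat by simp
    have "p ^ k \<le> e" using e(2) that BG by (metis subsetD)
    moreover have "k < p ^ k" using p by (simp add: power_gt_expt)
    moreover have "p \<le> p ^ k" using p that(4) by (simp add: self_le_power)
    ultimately show ?thesis by linarith
  qed
  have finM: "finite M"
    by (rule finite_subset[of _ "{..e}"]) (use bound in \<open>auto simp: M_def\<close>)
  have fink: "finite {k. \<exists>b\<in>B. ord b = p ^ k}" if "p \<in> M" for p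
  proof (rule finite_subset)
    show "{k. \<exists>b\<in>B. ord b = p ^ k} \<subseteq> {..e}"
    proof clarify
      fix k b assume "b \<in> B" "ord b = p ^ k"
      then show "k \<le> e" using bound[of p b k] that by (cases "k = 0") (auto simp: M_def)
    qed
  qed simp
  have cov: "\<exists>p\<in>M. \<exists>i\<in>{1..n p}. ord b = p ^ i" if b: "b \<in> B" for b
  proof -
    obtain p k where p: "Factorial_Ring.prime p" "0 < k" "ord b = p ^ k" using pp[OF b] by blast
    then have "p \<in> M" using b by (auto simp: M_def)
    moreover have "k \<le> n p" unfolding n_def using fink[OF \<open>p \<in> M\<close>] b p by (intro Max_ge) auto
    ultimately show ?thesis using p by (intro bexI[of _ p] bexI[of _ k]) simp_all
  qed
  have top: "\<exists>b\<in>B. ord b = p ^ n p" if "p \<in> M" for p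
  proof -
    have "n p \<in> {k. \<exists>b\<in>B. ord b = p ^ k}"
      unfolding n_def using fink[OF that] that by (intro Max_in) (auto simp: M_def)
    then show ?thesis by simp
  qed
  have n1: "1 \<le> n p" if p: "p \<in> M" for p
  proof -
    obtain b k where "b \<in> B" "0 < k" "ord b = p ^ k" using p by (auto simp: M_def)
    moreover from this have "k \<le> n p" unfolding n_def using fink[OF p] by (intro Max_ge) auto
    ultimately show ?thesis by linarith
  qed
  \<comment> \<open>the hypothesis concerns decompositions, so the basis has to be turned into one\<close>
  have "cyclic_decomposition G M n (\<lambda>i p. {b\<in>B. ord b = p ^ i})"
    using finM n1 top cov by (intro basis_cyclic_decomposition B) (auto simp: M_def)
  then have lead: "card_of {b\<in>B. ord b = p ^ n p} \<in> leading_ulm_kaplansky_invariants G" if "p \<in> M" for p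
    unfolding leading_ulm_kaplansky_invariants_def using that
    by (intro CollectI exI[of _ M] exI[of _ n] exI[of _ "\<lambda>i p. {b\<in>B. ord b = p ^ i}"] exI[of _ p]) simp
  have infK: "infinite {b\<in>B. ord b = p ^ n p}" if "p \<in> M" for p
    using inv[rule_format, OF lead[OF that]] by (simp add: cinfinite_def Field_card_of)
  obtain P where P: "\<And>b. b \<in> B \<Longrightarrow> P b \<in> M \<and> (\<exists>i\<in>{1..n (P b)}. ord b = P b ^ i)"
    using cov by metis
  \<comment> \<open>the modulus of the block that is to contain the basis element\<close>
  define N0 where "N0 = (\<lambda>b. if infinite {b'\<in>B. ord b' = ord b} then ord b else P b ^ n (P b))"
  have inf_ord: "infinite {b'\<in>B. ord b' = N0 b}" if "b \<in> B" for b
    using infK P that by (auto simp: N0_def)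
  have N0_pos: "0 < N0 b" if "b \<in> B" for b
  proof (rule ccontr)
    assume "\<not> 0 < N0 b"
    then have "infinite {b'\<in>B. ord b' = 0}" using inf_ord[OF that] by simp
    moreover have "ord b' \<noteq> 0" if "b' \<in> B" for b'
      using pp[OF that] by (metis not_prime_0 power_not_zero)
    ultimately show False by (metis (mono_tags, lifting) Collect_empty_eq finite.emptyI)
  qed
  have N0_dvd: "ord b dvd N0 b" if "b \<in> B" for b
    using P[OF that] by (auto simp: N0_def intro: le_imp_power_dvd)
  have "infinite {b'\<in>B. N0 b' = N0 b}" if "b \<in> B" for b
  proof (rule infinite_super[OF _ inf_ord[OF that]])
    show "{b'\<in>B. ord b' = N0 b} \<subseteq> {b'\<in>B. N0 b' = N0 b}"
      using inf_ord[OF that] unfolding N0_def by auto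
  qed
  moreover have "finite {b'\<in>B. N0 b' = N0 b \<and> ord b' \<noteq> N0 b}" for b
  proof (rule finite_subset)
    let ?D = "{k\<in>{..e}. finite {b'\<in>B. ord b' = k}}"
    show "{b'\<in>B. N0 b' = N0 b \<and> ord b' \<noteq> N0 b} \<subseteq> (\<Union>k\<in>?D. {b'\<in>B. ord b' = k})"
      using e(2) BG by (auto simp: N0_def split: if_splits)
    show "finite (\<Union>k\<in>?D. {b'\<in>B. ord b' = k})" by auto
  qed
  ultimately obtain lab :: "'a \<Rightarrow> nat \<times> 'a" and q :: "'a \<Rightarrow> real"
    where lab: "\<And>b. fst (lab b) = N0 b" and q: "\<And>b. b \<in> B \<Longrightarrow> 0 < q b" "\<And>b. b \<in> B \<Longrightarrow> q b < 1"
      "\<And>b b'. \<lbrakk>b \<in> B; b' \<in> B; lab b = lab b'; q b = q b'\<rbrakk> \<Longrightarrow> b = b'"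
      "\<And>b u v. \<lbrakk>b \<in> B; 0 \<le> u; u < v; v \<le> 1\<rbrakk>
        \<Longrightarrow> \<exists>b'\<in>B. lab b' = lab b \<and> ord b' = N0 b \<and> u < q b' \<and> q b' < v"
    by (rule exists_block_labelling[of B N0 ord]) blast+
  \<comment> \<open>the label records the modulus as its first component\<close>
  interpret block_basis G B lab q fst
    by unfold_locales (use B B_ne N0_pos N0_dvd q in \<open>simp_all add: lab\<close>)
  show ?thesis by (rule minimally_almost_periodic_topology)
qed

theorem theorem3:
  fixes G :: "('a, 'b) monoid_scheme"
  assumes "comm_group G" and "infinite (carrier G)" and "bounded_group G"
  shows "(\<exists>T. group_topology G T \<and> Hausdorff_space T \<and> minimally_almost_periodic G T)
    \<longleftrightarrow> (\<forall>\<kappa>\<in>leading_ulm_kaplansky_invariants G. cinfinite \<kappa>)"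
proof (intro iffI ballI)
  fix \<kappa> assume T: "\<exists>T. group_topology G T \<and> Hausdorff_space T \<and> minimally_almost_periodic G T"
    and "\<kappa> \<in> leading_ulm_kaplansky_invariants G"
  then obtain M n K p where K: "\<kappa> = card_of (K (n p) p)" "cyclic_decomposition G M n K" "p \<in> M"
    by (auto simp: leading_ulm_kaplansky_invariants_def)
  then have "infinite (K (n p) p)"
    using not_minimally_almost_periodic[OF assms(1) K(2,3)] T by blast
  then show "cinfinite \<kappa>" using K(1) by (simp add: cinfinite_def Field_card_of)
next
  assume "\<forall>\<kappa>\<in>leading_ulm_kaplansky_invariants G. cinfinite \<kappa>"
  then show "\<exists>T. group_topology G T \<and> Hausdorff_space T \<and> minimally_almost_periodic G T"
    by (rule comm_group.minimally_almost_periodic_if_infinite_invariants[OF assms])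
qed

end
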